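(* Let $r\ge 1$ and $s\ge 4$ be fixed integers and let $t=\lfloor (s-3)/2\rfloor$. Then, as $n\to\infty$, \[ F_{r,s}(n)\le \begin{cases} n\cdot 2^{(1/t!)\,\alpha(n)^t+O\left(\alpha(n)^{t-1}\right)}, & s \text{ odd},\\[2pt] n\cdot 2^{(1/t!)\,\alpha(n)^t\log_2\alpha(n)+O\left(\alpha(n)^{t}\right)}, & s \text{ even}, \end{cases} \] where the constants implicit in the $O$-notation depend on $r$ and $s$.
   Context: A sequence $a_1a_2a_3\ldots$ is $r$-sparse if $a_i\ne a_j$ whenever $1\le |i-j|\le r-1$. An $(r,s)$-formation is a concatenation of $s$ permutations of the same set of $r$ distinct symbols. A sequence $S$ contains an $(r,s)$-formation if some (not necessarily contiguous) subsequence of $S$ is an $(r,s)$-formation. A sequence is $(r,s)$-formation-free if it is $r$-sparse and contains no $(r,s)$-formation. $F_{r,s}(n)$ denotes the maximum length of an $(r,s)$-formation-free sequence on $n$ distinct symbols. The inverse Ackermann hierarchy is defined by $\alpha_1(x)=\lceil x/2\rceil$ and, for $k\ge 2$, $\alpha_k(x)=0$ if $x\le 1$ and $\alpha_k(x)=1+\alpha_k(\alpha_{k-1}(x))$ otherwise. The inverse Ackermann function is $\alpha(x)=\min\{k\mid\alpha_k(x)\le 3\}$. *)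

theory Defs
  imports
    Complex_Main
    "HOL-Library.Sublist"
    "HOL-Library.Landau_Symbols"
    "HOL-Combinatorics.Multiset_Permutations"
begin

definition sparse :: "nat \<Rightarrow> 'a list \<Rightarrow> bool" where
  "sparse r S \<longleftrightarrow> (\<forall>i<length S. \<forall>j<length S.
     1 \<le> \<bar>int i - int j\<bar> \<and> \<bar>int i - int j\<bar> \<le> int r - 1 \<longrightarrow> S ! i \<noteq> S ! j)"

definition is_formation :: "nat \<Rightarrow> nat \<Rightarrow> 'a list \<Rightarrow> bool" where
  "is_formation r s u \<longleftrightarrow> (\<exists>A ps. finite A \<and> card A = r \<and>
     length ps = s \<and> set ps \<subseteq> permutations_of_set A \<and> u = concat ps)"

definition contains_formation :: "nat \<Rightarrow> nat \<Rightarrow> 'a list \<Rightarrow> bool" where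
  "contains_formation r s S \<longleftrightarrow> (\<exists>u. is_formation r s u \<and> subseq u S)"

definition formation_free :: "nat \<Rightarrow> nat \<Rightarrow> 'a list \<Rightarrow> bool" where
  "formation_free r s S \<longleftrightarrow> sparse r S \<and> \<not> contains_formation r s S"

(* Symbols are natural numbers; this loses nothing, since all the notions above are
   invariant under renaming of symbols. *)
definition formation_free_lengths :: "nat \<Rightarrow> nat \<Rightarrow> nat \<Rightarrow> nat set" where
  "formation_free_lengths r s n =
     {length S |S :: nat list. formation_free r s S \<and> card (set S) = n}"

(* The maximum is attained whenever r >= 1 and s >= 2: see the lemmas
   finite_formation_free_lengths and formation_free_lengths_nonempty. *)
definition F :: "nat \<Rightarrow> nat \<Rightarrow> nat \<Rightarrow> nat" where
  "F r s n = Max (formation_free_lengths r s n)"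

(* The hierarchy starts at index 1; the value at index 0 is a dummy. *)
function (domintros) alpha_k :: "nat \<Rightarrow> nat \<Rightarrow> nat" where
  "alpha_k 0 x = 0"
| "alpha_k (Suc 0) x = nat \<lceil>real x / 2\<rceil>"
| "alpha_k (Suc (Suc k)) x =
     (if x \<le> 1 then 0 else 1 + alpha_k (Suc (Suc k)) (alpha_k (Suc k) x))"
  by pat_completeness auto

lemma ceiling_half_less: "2 \<le> x \<Longrightarrow> nat \<lceil>real x / 2\<rceil> < x"
  by linarith

lemma alpha_k_less_dom:
  "alpha_k_dom (k, x) \<Longrightarrow> 2 \<le> x \<Longrightarrow> alpha_k k x < x"
proof (induction k x rule: alpha_k.pinduct)
  case (1 x)
  then show ?case by (simp add: alpha_k.psimps)
next
  case (2 x)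
  then show ?case by (simp add: alpha_k.psimps ceiling_half_less)
next
  case (3 k x)
  define y where "y = alpha_k (Suc k) x"
  have y: "y < x"
    using 3 by (simp add: y_def)
  have "alpha_k (Suc (Suc k)) y < x - 1"
  proof (cases "y \<le> 1")
    case True
    have "alpha_k_dom (Suc (Suc k), y)"
      by (rule alpha_k.domintros) (use True in auto)
    then show ?thesis
      using True "3.prems" by (simp add: alpha_k.psimps)
  next
    case False
    then show ?thesis
      using 3 y by (force simp: y_def)
  qed
  then show ?case
    using 3 by (simp add: alpha_k.psimps y_def)
qed

termination alpha_k
proof (relation "measures [fst, snd]")
  fix k x :: nat
  assume "\<not> x \<le> 1" and "alpha_k_dom (Suc k, x)"
  then show "((Suc (Suc k), alpha_k (Suc k) x), (Suc (Suc k), x))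
      \<in> measures [fst, snd]"
    using alpha_k_less_dom by auto
qed auto

definition inv_ackermann :: "nat \<Rightarrow> nat" where
  "inv_ackermann x = (LEAST k. 1 \<le> k \<and> alpha_k k x \<le> 3)"

lemma alpha_k_less: "2 \<le> x \<Longrightarrow> alpha_k k x < x"
proof (induction k x rule: alpha_k.induct)
  case (2 x)
  then show ?case by (simp add: ceiling_half_less)
next
  case (3 k x)
  let ?y = "alpha_k (Suc k) x"
  have "?y < x" using 3 by simp
  moreover have "alpha_k (Suc (Suc k)) ?y < x - 1"
    using 3 \<open>?y < x\<close> by (cases "?y \<le> 1") force+
  ultimately show ?case using 3 by simp
qed simp

lemma alpha_k_le: "alpha_k k x \<le> x"
proof (cases "x \<le> 1")
  case True
  then show ?thesis
    by (induction k x rule: alpha_k.induct) simp_all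
qed (use alpha_k_less[of x k] in auto)

lemma alpha_k_gap:
  assumes "4 \<le> x"
  shows "alpha_k k x + 2 \<le> x"
proof -
  have "alpha_k k x + 2 \<le> x" if "k = Suc j" for j
    using that
  proof (induction j arbitrary: k)
    case 0
    then show ?case using assms by simp linarith
  next
    case (Suc j)
    let ?y = "alpha_k (Suc j) x"
    have "?y + 2 \<le> x" using Suc.IH by simp
    moreover have "alpha_k k ?y < max ?y 2"
      using alpha_k_less[of ?y k] alpha_k_le[of k ?y] by (cases "2 \<le> ?y") auto
    moreover have "alpha_k k x = 1 + alpha_k k ?y"
      using Suc.prems assms by simp
    ultimately show ?case using assms by linarith
  qed
  then show ?thesis using assms by (cases k) auto
qed

(* The minimum defining the inverse Ackermann function is over a nonempty set. *)
lemma ex_alpha_k_le_3: "\<exists>k\<ge>1. alpha_k k x \<le> 3"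
proof (rule ccontr)
  assume neg: "\<not> ?thesis"
  have "alpha_k (Suc k) x + k \<le> x" for k
  proof (induction k)
    case 0
    then show ?case using alpha_k_le[of "Suc 0" x] by simp
  next
    case (Suc k)
    let ?y = "alpha_k (Suc k) x"
    have "\<not> ?y \<le> 3" using neg by auto
    then have "4 \<le> ?y" by linarith
    moreover have "2 \<le> x" using \<open>4 \<le> ?y\<close> alpha_k_le[of "Suc k" x] by linarith
    ultimately show ?case
      using alpha_k_gap[of ?y "Suc (Suc k)"] Suc.IH by simp
  qed
  from this[of "Suc x"] show False by simp
qed

lemma sparse_block_distinct:
  assumes "sparse r S"
  shows "distinct (take r (drop m S))"
  unfolding distinct_conv_nth
proof (intro allI impI)
  fix i j assume "i < length (take r (drop m S))" "j < length (take r (drop m S))" "i \<noteq> j"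
  then have ij: "i < r" "j < r" "m + i < length S" "m + j < length S" "i \<noteq> j"
    by auto
  then have "1 \<le> \<bar>int (m + i) - int (m + j)\<bar>"
    "\<bar>int (m + i) - int (m + j)\<bar> \<le> int r - 1"
    by linarith+
  then have "S ! (m + i) \<noteq> S ! (m + j)"
    using assms ij by (metis sparse_def)
  then show "take r (drop m S) ! i \<noteq> take r (drop m S) ! j"
    using ij by simp
qed

lemma concat_blocks: "concat (map (\<lambda>i. take r (drop (i * r) S)) [0..<m]) = take (m * r) S"
  proof (induction m)
  case (Suc m)
  then show ?case
    using take_add[of "m * r" r S] by (simp add: add.commute)
qed simp

lemma subseq_concat: "subseq xs ys \<Longrightarrow> subseq (concat xs) (concat ys)"
proof (induction rule: list_emb.induct)
  case (list_emb_Cons xs ys y)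
  then show ?case by (simp add: list_emb_append2)
qed (simp_all add: list_emb_append_mono)

lemma formation_free_length_bound:
  fixes S :: "'a list"
  assumes free: "formation_free r s S" and r: "1 \<le> r"
  shows "length S \<le> r * (s * 2 ^ card (set S) + 1)"
proof (rule ccontr)
  assume long: "\<not> ?thesis"
  define m where "m = s * 2 ^ card (set S) + 1"
  define b where "b = (\<lambda>i. take r (drop (i * r) S))"
  have b_in: "(i + 1) * r \<le> length S" if "i < m" for i
  proof -
    have "(i + 1) * r \<le> m * r" using that by (intro mult_right_mono) auto
    also have "m * r < length S" using long by (simp add: m_def mult.commute)
    finally show ?thesis by simp
  qed
  have dist: "distinct (b i)" for i
    using free by (auto simp: b_def formation_free_def intro: sparse_block_distinct)
  have sub: "set (b i) \<subseteq> set S" for i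
    unfolding b_def by (meson set_take_subset set_drop_subset subset_trans)
  have "\<exists>A\<in>Pow (set S). s \<le> card {i. i < m \<and> set (b i) = A}"
  proof (rule ccontr)
    assume "\<not> ?thesis"
    then have small: "card {i. i < m \<and> set (b i) = A} \<le> s" if "A \<in> Pow (set S)" for A
      using that by (meson linear)
    have "{..<m} = (\<Union>A\<in>Pow (set S). {i. i < m \<and> set (b i) = A})"
      using sub by auto
    then have "m \<le> (\<Sum>A\<in>Pow (set S). card {i. i < m \<and> set (b i) = A})"
      by (metis card_UN_le card_lessThan finite_Pow_iff finite_set)
    also have "\<dots> \<le> (\<Sum>A\<in>Pow (set S). s)"
      by (intro sum_mono small)
    also have "\<dots> = s * 2 ^ card (set S)"
      by (simp add: card_Pow)
    finally show False by (simp add: m_def)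
  qed
  then obtain A where A: "s \<le> card {i. i < m \<and> set (b i) = A}" "A \<subseteq> set S" by auto
  define qs where "qs = filter (\<lambda>p. set p = A) (map b [0..<m])"
  have len_qs: "length qs = card {i. i < m \<and> set (b i) = A}"
    by (simp add: qs_def length_filter_conv_card cong: conj_cong)
  have "contains_formation r s S"
  proof (cases "s = 0")
    case True
    have "is_formation r s ([] :: 'a list)"
    proof -
      have "m = 1" "1 * r \<le> length S" using True b_in[of 0] by (simp_all add: m_def)
      then have "finite (set (b 0))" "card (set (b 0)) = r"
        using dist[of 0] by (simp_all add: b_def distinct_card)
      then show ?thesis using True by (auto simp: is_formation_def)
    qed
    then show ?thesis by (auto simp: contains_formation_def)
  next
    case False
    then have "{i. i < m \<and> set (b i) = A} \<noteq> {}" using A(1) by force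
    then obtain i where i: "i < m" "set (b i) = A" by auto
    have "card A = r"
      using i b_in[of i] dist[of i] distinct_card[of "b i"] by (simp add: b_def)
    moreover have "set (take s qs) \<subseteq> permutations_of_set A"
      using dist by (auto simp: qs_def permutations_of_set_def dest!: in_set_takeD)
    moreover have "length (take s qs) = s" using A(1) len_qs by simp
    moreover have "finite A" using A(2) finite_subset by blast
    ultimately have "is_formation r s (concat (take s qs))"
      unfolding is_formation_def by blast
    moreover have "subseq (concat (take s qs)) S"
    proof -
      have "subseq (take s qs) qs" by (meson prefix_imp_subseq take_is_prefix)
      moreover have "subseq qs (map b [0..<m])" by (simp add: qs_def)
      ultimately have "subseq (concat (take s qs)) (concat (map b [0..<m]))"
        by (meson subseq_concat subseq_order.trans)
      also have "concat (map b [0..<m]) = take (m * r) S"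
        unfolding b_def by (rule concat_blocks)
      also have "subseq \<dots> S" by (meson prefix_imp_subseq take_is_prefix)
      finally show ?thesis .
    qed
    ultimately show ?thesis by (auto simp: contains_formation_def)
  qed
  then show False using free by (simp add: formation_free_def)
qed

lemma finite_formation_free_lengths:
  assumes "1 \<le> r"
  shows "finite (formation_free_lengths r s n)"
proof (rule finite_subset)
  show "formation_free_lengths r s n \<subseteq> {..r * (s * 2 ^ n + 1)}"
    using formation_free_length_bound[OF _ assms] by (auto simp: formation_free_lengths_def)
qed simp

lemma formation_free_lengths_nonempty:
  assumes "1 \<le> r" "2 \<le> s"
  shows "n \<in> formation_free_lengths r s n"
proof -
  let ?S = "[0..<n]"
  have "\<not> contains_formation r s ?S"
  proof
    assume "contains_formation r s ?S"
    then obtain A ps where ps: "finite A" "card A = r" "length ps = s"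
      "set ps \<subseteq> permutations_of_set A" "subseq (concat ps) ?S"
      by (auto simp: contains_formation_def is_formation_def)
    from ps(3) assms(2) obtain p q rest where eq: "ps = p # q # rest"
      by (metis Suc_le_length_iff numeral_2_eq_2)
    have "distinct (concat ps)"
      using ps(5) by (auto simp: subseq_conv_nths)
    moreover have "set p = A" "set q = A"
      using ps(4) eq by (auto simp: permutations_of_set_def)
    ultimately have "A = {}" using eq by auto
    then show False using ps(2) assms(1) by simp
  qed
  then have "formation_free r s ?S"
    by (auto simp: formation_free_def sparse_def)
  then show ?thesis
    unfolding formation_free_lengths_def by (intro CollectI exI[of _ ?S]) auto
qed

end

theory Submission
  imports Defs
begin

text \<open>A formation-free sequence over \<open>n\<close> symbols is cut into at most \<open>2 * n + 1\<close> chunks free of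
  formations of order \<open>s - 2\<close>; by induction on \<open>s\<close> each chunk is not much longer than its number of
  distinct symbols, so the problem reduces to sequences of \<open>m = O(n)\<close> blocks without repetition
  inside a block. There one bounds, following Nivasch, the number of symbols that can occur more
  than \<open>R\<close> times each. Cutting the blocks into parts, a symbol either has many occurrences in a part,
  where the rest of the sequence supplies one or two further permutations of a formation, or it
  meets many parts and is counted in the contracted sequence with one block per part. The resulting
  Ackermann-like recursion shows that there are only \<open>O(m)\<close> such symbols once \<open>R\<close> reaches a
  threshold that depends on the inverse Ackermann function of \<open>n\<close>; this threshold is the factor in
  the theorem.\<close>

section \<open>Symbols in block sequences\<close>

text \<open>The exponent comes from Pascal's rule. A symbol that escapes all charges meets few parts
  and has few occurrences in each, so thresholds multiply: up to lower terms, the new threshold is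
  the one two orders below at the same level times the one of the same order one level below.
  Logarithms then add like binomial coefficients, and \<open>(d + t) choose t\<close> grows like
  \<open>d ^ t / t!\<close>, where \<open>d\<close> is \<alpha>(n). The parity of \<open>s\<close>
  matters because of the first nonconstant thresholds: order 4 has one linear in \<open>d\<close>,
  order 5 one of size about \<open>2 ^ d\<close>. The logarithm of the former is the factor log
  \<alpha>(n) that all even orders inherit. The obstacle is that the constant in front of
  \<open>m\<close> must not grow with the level; \<open>few_symbols_level\<close> therefore runs the
  hierarchy on exponents of lengths, so that the loss at a lower level is paid for by the length of
  the parts.\<close>

definition occ :: "'a \<Rightarrow> 'a set list \<Rightarrow> nat" where
  "occ a P = length (filter (\<lambda>B. a \<in> B) P)"

lemma occ_append [simp]: "occ a (P @ Q) = occ a P + occ a Q"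
  by (simp add: occ_def)

lemma occ_pos: "0 < occ a P \<longleftrightarrow> a \<in> \<Union>(set P)"
  by (auto simp: occ_def filter_empty_conv)

lemma occ_eq_0: "occ a P = 0 \<longleftrightarrow> a \<notin> \<Union>(set P)"
  using occ_pos[of a P] by auto

lemma occ_le_length: "occ a P \<le> length P"
  by (simp add: occ_def)

lemma occ_conv_card: "occ a P = card {i. i < length P \<and> a \<in> P ! i}"
  by (simp add: occ_def length_filter_conv_card)

lemma occ_concat: "occ a (concat Ps) = (\<Sum>i<length Ps. occ a (Ps ! i))"
proof (induction Ps rule: rev_induct)
  case (snoc P Ps)
  then show ?case by (simp add: nth_append)
qed (simp add: occ_def)

lemma split_at_nth:
  "i < length Ps \<Longrightarrow> concat Ps = concat (take i Ps) @ Ps ! i @ concat (drop (Suc i) Ps)"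
  by (metis concat.simps(2) concat_append id_take_nth_drop)

text \<open>Blocks are sets: the order inside a block is forgotten, and a formation must then respect the
  block boundaries. This weakens formation-freeness, so upper bounds carry over to sequences.\<close>

primrec spans :: "'a set \<Rightarrow> nat \<Rightarrow> 'a set list \<Rightarrow> bool" where
  "spans A 0 P \<longleftrightarrow> True"
| "spans A (Suc s) P \<longleftrightarrow> (\<exists>C Q. P = C @ Q \<and> A \<subseteq> \<Union>(set C) \<and> spans A s Q)"

lemma spans_append_left: "spans A s P \<Longrightarrow> spans A s (X @ P)"
proof (cases s)
  case (Suc s')
  assume "spans A s P"
  then obtain C Q where "P = C @ Q" "A \<subseteq> \<Union>(set C)" "spans A s' Q"
    using Suc by auto
  then have "X @ P = (X @ C) @ Q \<and> A \<subseteq> \<Union>(set (X @ C)) \<and> spans A s' Q"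
    by auto
  then show ?thesis unfolding Suc spans.simps by blast
qed simp

lemma spans_append_right: "spans A s P \<Longrightarrow> spans A s (P @ Y)"
proof (induction s arbitrary: P)
  case (Suc s)
  then show ?case by fastforce
qed simp

lemma spans_cover_left:
  "A \<subseteq> \<Union>(set C) \<Longrightarrow> spans A s P \<Longrightarrow> spans A (Suc s) (C @ P)"
  by auto

lemma spans_cover_right:
  "spans A s P \<Longrightarrow> A \<subseteq> \<Union>(set C) \<Longrightarrow> spans A (Suc s) (P @ C)"
proof (induction s arbitrary: P)
  case 0
  have "P @ C = (P @ C) @ []" "A \<subseteq> \<Union>(set (P @ C))" using 0 by auto
  then show ?case unfolding spans.simps by blast
next
  case (Suc s)
  then obtain D Q where D: "P = D @ Q" "A \<subseteq> \<Union>(set D)" "spans A s Q" by auto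
  then have "P @ C = D @ (Q @ C)" "spans A (Suc s) (Q @ C)" using Suc by auto
  with D(2) show ?case unfolding spans.simps(2)[of A "Suc s"] by blast
qed

text \<open>A factor of the contracted sequence is a run of whole parts, hence a factor of the
  original as well. Freeness therefore passes to the contracted sequence.\<close>

lemma spans_concat:
  "spans A s (map (\<lambda>P. \<Union>(set P)) Ps) \<Longrightarrow> spans A s (concat Ps)"
proof (induction s arbitrary: Ps)
  case (Suc s)
  then obtain C Q where *: "map (\<lambda>P. \<Union>(set P)) Ps = C @ Q" "A \<subseteq> \<Union>(set C)" "spans A s Q"
    by auto
  then obtain Cs Qs where "Ps = Cs @ Qs" "C = map (\<lambda>P. \<Union>(set P)) Cs"
    "Q = map (\<lambda>P. \<Union>(set P)) Qs"
    by (auto simp: map_eq_append_conv)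
  moreover have "A \<subseteq> \<Union>(set (concat Cs))" using *(2) \<open>C = _\<close> by fastforce
  ultimately show ?case
    using Suc.IH[of Qs] * spans_cover_left[of A "concat Cs" s "concat Qs"] by simp
qed simp

lemma spans_image:
  assumes "list_all2 (\<lambda>B' B. f ` B' \<subseteq> B) P' P" and "spans A s P'"
  shows "spans (f ` A) s P"
  using assms
proof (induction s arbitrary: P' P)
  case (Suc s)
  then obtain C' Q' where *: "P' = C' @ Q'" "A \<subseteq> \<Union>(set C')" "spans A s Q'" by auto
  then obtain C Q where CQ: "P = C @ Q" "list_all2 (\<lambda>B' B. f ` B' \<subseteq> B) C' C"
      "list_all2 (\<lambda>B' B. f ` B' \<subseteq> B) Q' Q"
    using Suc.prems by (auto simp: list_all2_append1)
  have "f ` A \<subseteq> \<Union>(set C)"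
  proof
    fix y assume "y \<in> f ` A"
    then obtain x B' where x: "y = f x" "B' \<in> set C'" "x \<in> B'" using * by auto
    then obtain i where i: "i < length C'" "C' ! i = B'" by (auto simp: in_set_conv_nth)
    then have "f ` B' \<subseteq> C ! i" using list_all2_nthD[OF CQ(2)] by blast
    moreover have "C ! i \<in> set C" using i list_all2_lengthD[OF CQ(2)] by simp
    ultimately show "y \<in> \<Union>(set C)" using x by auto
  qed
  then show ?case using CQ Suc.IH[OF CQ(3) *(3)] by auto
qed simp

declare spans.simps(2) [simp del]

text \<open>Freeness is demanded of the counted symbols \<open>X\<close> only, while blocks may
  contain others. Thus one may pass to a subset of the symbols without touching the blocks. The type
  is a parameter because \<open>sum_occ_le\<close> needs the bound for pairs.\<close>

definition few_symbols :: "'a itself \<Rightarrow> nat \<Rightarrow> nat \<Rightarrow> nat \<Rightarrow> nat \<Rightarrow> nat \<Rightarrow> bool" where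
  "few_symbols (_ :: 'a itself) r s R M c \<longleftrightarrow>
     (\<forall>P (X :: 'a set). length P \<le> M \<longrightarrow> finite X \<longrightarrow> (\<forall>a\<in>X. R < occ a P) \<longrightarrow>
        (\<forall>A\<subseteq>X. card A = r \<longrightarrow> \<not> spans A s P) \<longrightarrow> card X \<le> c * length P)"

lemma few_symbolsD:
  assumes "few_symbols TYPE('a) r s R M c" "length P \<le> M" "finite X"
    "\<And>a. a \<in> X \<Longrightarrow> R < occ a P"
    "\<And>A. A \<subseteq> X \<Longrightarrow> card A = r \<Longrightarrow> \<not> spans A s P"
  shows "card (X :: 'a set) \<le> c * length P"
  using assms unfolding few_symbols_def by blast

lemma few_symbolsI:
  assumes "\<And>P (X :: 'a set). length P \<le> M \<Longrightarrow> finite X \<Longrightarrow> (\<And>a. a \<in> X \<Longrightarrow> R < occ a P) \<Longrightarrow>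
        (\<And>A. A \<subseteq> X \<Longrightarrow> card A = r \<Longrightarrow> \<not> spans A s P) \<Longrightarrow> card X \<le> c * length P"
  shows "few_symbols TYPE('a) r s R M c"
  unfolding few_symbols_def by (intro allI impI assms) auto

lemma few_symbols_mono:
  assumes "few_symbols TYPE('a) r s R M c" "R \<le> R'" "M' \<le> M" "c \<le> c'"
  shows "few_symbols TYPE('a) r s R' M' c'"
proof (rule few_symbolsI)
  fix P and X :: "'a set"
  assume *: "length P \<le> M'" "finite X" "\<And>a. a \<in> X \<Longrightarrow> R' < occ a P"
    "\<And>A. A \<subseteq> X \<Longrightarrow> card A = r \<Longrightarrow> \<not> spans A s P"
  have "R < occ a P" if "a \<in> X" for a using *(3)[OF that] assms(2) by linarith
  then have "card X \<le> c * length P"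
    using * assms by (intro few_symbolsD[OF assms(1)]) auto
  also have "\<dots> \<le> c' * length P" using assms by simp
  finally show "card X \<le> c' * length P" .
qed

lemma few_symbols_trivial:
  assumes "M \<le> R"
  shows "few_symbols TYPE('a) r s R M c"
proof (rule few_symbolsI)
  fix P and X :: "'a set"
  assume "length P \<le> M" and occ: "\<And>a. a \<in> X \<Longrightarrow> R < occ a P"
  then have "\<not> R < occ a P" for a using occ_le_length[of a P] assms by linarith
  then have "X = {}" using occ by blast
  then show "card X \<le> c * length P" by simp
qed

text \<open>Each symbol is charged to a part of the block sequence, where it has many occurrences and
  spans fewer factors because the occurrences in earlier or later parts supply further ones.
  A symbol that cannot be charged meets many parts, and counts in the contracted sequence.\<close>

lemma card_decomposition:
  fixes X :: "'a set"
  assumes c: "few_symbols TYPE('a) r (s + 2) (2 * R1 + R2 * R3) M c"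
    and c1: "few_symbols TYPE('a) r (s + 1) R1 M c1"
    and c2: "few_symbols TYPE('a) r s R2 M c2"
    and c3: "few_symbols TYPE('a) r (s + 2) R3 (length Ps) c3"
    and len: "\<And>P. P \<in> set Ps \<Longrightarrow> length P \<le> M"
    and fin: "finite X"
    and occ: "\<And>a. a \<in> X \<Longrightarrow> 2 * R1 + R2 * R3 < occ a (concat Ps)"
    and free: "\<And>A. A \<subseteq> X \<Longrightarrow> card A = r \<Longrightarrow> \<not> spans A (s + 2) (concat Ps)"
  shows "card X \<le> (c + 2 * c1 + c2) * length (concat Ps) + c3 * length Ps"
proof -
  define n where "n = length Ps"
  define bef where "bef i = \<Union>(set (concat (take i Ps)))" for i
  define aft where "aft i = \<Union>(set (concat (drop (Suc i) Ps)))" for i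
  \<comment> \<open>\<open>L\<close> gets no help from outside: same order and threshold, but on a
    shorter sequence. \<open>B\<close> and \<open>E\<close> get one permutation from the later or
    the earlier parts, which leaves order \<open>s + 1\<close>; \<open>I\<close> gets both, which
    leaves order \<open>s\<close>. \<open>H\<close> collects the symbols that meet more than
    \<open>R3\<close> parts.\<close>
  define L where "L i = {a \<in> X. 2 * R1 + R2 * R3 < occ a (Ps ! i)}" for i
  define B where "B i = {a \<in> X. a \<in> aft i \<and> R1 < occ a (Ps ! i)}" for i
  define E where "E i = {a \<in> X. a \<in> bef i \<and> R1 < occ a (Ps ! i)}" for i
  define I where "I i = {a \<in> X. a \<in> bef i \<and> a \<in> aft i \<and> R2 < occ a (Ps ! i)}" for i
  define Q where "Q = map (\<lambda>P. \<Union>(set P)) Ps"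
  define H where "H = {a \<in> X. R3 < occ a Q}"
  note defs = L_def B_def E_def I_def H_def
  have fins: "finite (L i)" "finite (B i)" "finite (E i)" "finite (I i)" "finite H" for i
    using fin by (simp_all add: defs)
  have ext: "\<not> spans A (s + 2) (concat (take i Ps) @ Ps ! i @ concat (drop (Suc i) Ps))"
    if "i < n" "A \<subseteq> X" "card A = r" for i A
    using free[OF that(2,3)] split_at_nth[of i Ps] that(1) by (simp add: n_def)
  have Lc: "card (L i) \<le> c * length (Ps ! i)" if "i < n" for i
  proof (rule few_symbolsD[OF c])
    fix A assume A: "A \<subseteq> L i" "card A = r"
    then have "A \<subseteq> X" by (auto simp: L_def)
    then show "\<not> spans A (s + 2) (Ps ! i)"
      using ext[OF that _ A(2)] by (blast intro: spans_append_left spans_append_right)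
  qed (use len that fins in \<open>auto simp: L_def n_def\<close>)
  have Bc: "card (B i) \<le> c1 * length (Ps ! i)" if "i < n" for i
  proof (rule few_symbolsD[OF c1])
    fix A assume A: "A \<subseteq> B i" "card A = r"
    show "\<not> spans A (s + 1) (Ps ! i)"
    proof
      assume "spans A (s + 1) (Ps ! i)"
      moreover have "A \<subseteq> aft i" using A by (auto simp: B_def)
      ultimately have "spans A (s + 2) (Ps ! i @ concat (drop (Suc i) Ps))"
        using spans_cover_right[of A "s + 1" "Ps ! i"] by (simp add: aft_def)
      then show False
        using ext[OF that, of A] A by (auto simp: B_def intro: spans_append_left)
    qed
  qed (use len that fins in \<open>auto simp: B_def n_def\<close>)
  have Ec: "card (E i) \<le> c1 * length (Ps ! i)" if "i < n" for i
  proof (rule few_symbolsD[OF c1])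
    fix A assume A: "A \<subseteq> E i" "card A = r"
    show "\<not> spans A (s + 1) (Ps ! i)"
    proof
      assume "spans A (s + 1) (Ps ! i)"
      then have "spans A (s + 1) (Ps ! i @ concat (drop (Suc i) Ps))"
        by (rule spans_append_right)
      moreover have "A \<subseteq> bef i" using A by (auto simp: E_def)
      ultimately have "spans A (s + 2) (concat (take i Ps) @ Ps ! i @ concat (drop (Suc i) Ps))"
        using spans_cover_left[of A "concat (take i Ps)" "s + 1"] by (simp add: bef_def)
      then show False
        using ext[OF that, of A] A by (auto simp: E_def)
    qed
  qed (use len that fins in \<open>auto simp: E_def n_def\<close>)
  have Ic: "card (I i) \<le> c2 * length (Ps ! i)" if "i < n" for i
  proof (rule few_symbolsD[OF c2])
    fix A assume A: "A \<subseteq> I i" "card A = r"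
    show "\<not> spans A s (Ps ! i)"
    proof
      assume "spans A s (Ps ! i)"
      moreover have "A \<subseteq> aft i" "A \<subseteq> bef i" using A by (auto simp: I_def)
      ultimately have "spans A (s + 2) (concat (take i Ps) @ Ps ! i @ concat (drop (Suc i) Ps))"
        using spans_cover_right[of A s "Ps ! i"]
          spans_cover_left[of A "concat (take i Ps)" "s + 1"]
        by (simp add: bef_def aft_def)
      then show False
        using ext[OF that, of A] A by (auto simp: I_def)
    qed
  qed (use len that fins in \<open>auto simp: I_def n_def\<close>)
  have Hc: "card H \<le> c3 * length Ps"
  proof -
    have "card H \<le> c3 * length Q"
    proof (rule few_symbolsD[OF c3])
      fix A assume A: "A \<subseteq> H" "card A = r"
      then have "A \<subseteq> X" by (auto simp: H_def)
      then show "\<not> spans A (s + 2) Q"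
        using free[OF _ A(2)] spans_concat[of A "s + 2" Ps] by (auto simp: Q_def)
    qed (use fins in \<open>auto simp: H_def Q_def\<close>)
    then show ?thesis by (simp add: Q_def)
  qed
  have cover: "X \<subseteq> (\<Union>i<n. L i \<union> B i \<union> E i \<union> I i) \<union> H"
  proof
    fix a assume a: "a \<in> X"
    show "a \<in> (\<Union>i<n. L i \<union> B i \<union> E i \<union> I i) \<union> H"
    proof (rule ccontr)
      assume neg: "\<not> ?thesis"
      define J where "J = {i. i < n \<and> a \<in> \<Union>(set (Ps ! i))}"
      define J1 where "J1 = {i \<in> J. a \<notin> bef i}"
      define J2 where "J2 = {i \<in> J. a \<notin> aft i}"
      have finJ: "finite J" "finite J1" "finite J2" by (auto simp: J_def J1_def J2_def)
      have befI: "a \<in> bef j" "a \<in> aft i" if "i < j" "i \<in> J" "j \<in> J" for i j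
      proof -
        have "Ps ! i = take j Ps ! i" "i < length (take j Ps)"
          using that by (auto simp: J_def n_def)
        then have "Ps ! i \<in> set (take j Ps)" by (metis nth_mem)
        then show "a \<in> bef j" using that by (auto simp: J_def bef_def)
        have "Ps ! j = drop (Suc i) Ps ! (j - Suc i)" "j - Suc i < length (drop (Suc i) Ps)"
          using that by (auto simp: J_def n_def)
        then have "Ps ! j \<in> set (drop (Suc i) Ps)" by (metis nth_mem)
        then show "a \<in> aft i" using that by (auto simp: J_def aft_def)
      qed
      have J1: "card J1 \<le> 1" unfolding J1_def
      proof (rule card_le_Suc0_iff_eq[THEN iffD2, unfolded One_nat_def[symmetric]])
        show "\<forall>x\<in>{i \<in> J. a \<notin> bef i}. \<forall>y\<in>{i \<in> J. a \<notin> bef i}. x = y"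
          using befI by (metis (mono_tags, lifting) linorder_neqE_nat mem_Collect_eq)
      qed (use finJ in simp)
      have J2: "card J2 \<le> 1" unfolding J2_def
      proof (rule card_le_Suc0_iff_eq[THEN iffD2, unfolded One_nat_def[symmetric]])
        show "\<forall>x\<in>{i \<in> J. a \<notin> aft i}. \<forall>y\<in>{i \<in> J. a \<notin> aft i}. x = y"
          using befI by (metis (mono_tags, lifting) linorder_neqE_nat mem_Collect_eq)
      qed (use finJ in simp)
      have J3: "card J \<le> R3"
      proof -
        have "J = {i. i < length Q \<and> a \<in> Q ! i}" by (auto simp: J_def Q_def n_def)
        then show ?thesis using neg a by (auto simp: H_def occ_conv_card)
      qed
      \<comment> \<open>Otherwise all occurrences of \<open>a\<close> lie in part \<open>i\<close>,
        and \<open>a\<close> would be charged to \<open>L i\<close>.\<close>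
      have global: "a \<in> bef i \<or> a \<in> aft i" if "i < n" for i
      proof (rule ccontr)
        assume "\<not> ?thesis"
        then have "occ a (concat Ps) = occ a (Ps ! i)"
          using split_at_nth[of i Ps] that
          by (simp add: n_def occ_eq_0 bef_def aft_def del: UN_simps)
        moreover have "a \<notin> L i" using neg that by auto
        ultimately show False using occ[OF a] a by (simp add: L_def)
      qed
      \<comment> \<open>For an uncharged symbol, the first and the last part that it meets hold at
        most \<open>R1\<close> occurrences each, and every part between them at most
        \<open>R2\<close>.\<close>
      have "occ a (Ps ! i) \<le> (if i \<in> J1 then R1 else 0) + (if i \<in> J2 then R1 else 0)
          + (if i \<in> J then R2 else 0)" if i: "i < n" for i
      proof (cases "i \<in> J")
        case True
        have "a \<notin> B i" "a \<notin> E i" "a \<notin> I i" using neg i by auto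
        then show ?thesis
          using global[OF i] True a by (auto simp: B_def E_def I_def J1_def J2_def)
      next
        case False
        then show ?thesis using i occ_eq_0[of a "Ps ! i"] by (auto simp: J_def)
      qed
      then have "occ a (concat Ps) \<le> (\<Sum>i<n. (if i \<in> J1 then R1 else 0) +
          (if i \<in> J2 then R1 else 0) + (if i \<in> J then R2 else 0))"
        unfolding occ_concat n_def by (intro sum_mono) auto
      also have "\<dots> = card J1 * R1 + card J2 * R1 + card J * R2"
      proof -
        have "J1 \<subseteq> {..<n}" "J2 \<subseteq> {..<n}" "J \<subseteq> {..<n}" by (auto simp: J_def J1_def J2_def)
        then show ?thesis by (simp add: sum.distrib sum.If_cases Int_absorb1)
      qed
      also have "\<dots> \<le> 1 * R1 + 1 * R1 + R3 * R2"
        by (intro add_mono mult_mono J1 J2 J3) auto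
      finally show False using occ[OF a] by (simp add: mult.commute)
    qed
  qed
  have "card X \<le> card ((\<Union>i<n. L i \<union> B i \<union> E i \<union> I i) \<union> H)"
    using fins by (intro card_mono cover) auto
  also have "\<dots> \<le> card (\<Union>i<n. L i \<union> B i \<union> E i \<union> I i) + card H"
    by (rule card_Un_le)
  also have "card (\<Union>i<n. L i \<union> B i \<union> E i \<union> I i) \<le> (\<Sum>i<n. card (L i \<union> B i \<union> E i \<union> I i))"
    by (rule card_UN_le) simp
  also have "\<dots> \<le> (\<Sum>i<n. (c + 2 * c1 + c2) * length (Ps ! i))"
  proof (rule sum_mono)
    fix i assume "i \<in> {..<n}"
    then have i: "i < n" by simp
    have "card (L i \<union> B i \<union> E i \<union> I i) \<le> card (L i) + card (B i) + card (E i) + card (I i)"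
      by (meson add_le_mono1 card_Un_le order_trans)
    also have "\<dots> \<le> (c + 2 * c1 + c2) * length (Ps ! i)"
      using Lc[OF i] Bc[OF i] Ec[OF i] Ic[OF i] by (simp add: algebra_simps)
    finally show "card (L i \<union> B i \<union> E i \<union> I i) \<le> (c + 2 * c1 + c2) * length (Ps ! i)" .
  qed
  also have "\<dots> = (c + 2 * c1 + c2) * length (concat Ps)"
    by (simp add: sum_distrib_left length_concat sum_list_sum_nth n_def atLeast0LessThan)
  finally show ?thesis using Hc by simp
qed

section \<open>Orders 2 and 3\<close>

lemma card_le_by_index:
  fixes X :: "'a set"
  assumes r: "r \<ge> 1" and fin: "finite X"
    and ex: "\<And>a. a \<in> X \<Longrightarrow> \<exists>i<m. Q i a"
    and no: "\<And>i A. i < m \<Longrightarrow> A \<subseteq> {a \<in> X. Q i a} \<Longrightarrow> card A \<noteq> r"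
  shows "card X \<le> r * m"
proof -
  have "X \<subseteq> (\<Union>i<m. {a \<in> X. Q i a})" using ex by auto
  then have "card X \<le> card (\<Union>i<m. {a \<in> X. Q i a})"
    using fin by (intro card_mono) auto
  also have "\<dots> \<le> (\<Sum>i<m. card {a \<in> X. Q i a})" by (rule card_UN_le) simp
  also have "\<dots> \<le> (\<Sum>i<m. r)"
  proof (rule sum_mono)
    fix i assume "i \<in> {..<m}"
    then show "card {a \<in> X. Q i a} \<le> r"
      using no[of i] obtain_subset_with_card_n[of r "{a \<in> X. Q i a}"]
      by (cases "r \<le> card {a \<in> X. Q i a}") auto
  qed
  finally show ?thesis by (simp add: mult.commute)
qed

text \<open>A block and all that follows it are two factors, so fewer than \<open>r\<close> symbols
  of \<open>X\<close> have an occurrence in a given block that is not their last.\<close>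

lemma few_symbols_2:
  assumes r: "r \<ge> 1"
  shows "few_symbols TYPE('a) r 2 1 M r"
proof (rule few_symbolsI)
  fix P and X :: "'a set"
  assume fin: "finite X" and occ: "\<And>a. a \<in> X \<Longrightarrow> 1 < occ a P"
    and free: "\<And>A. A \<subseteq> X \<Longrightarrow> card A = r \<Longrightarrow> \<not> spans A 2 P"
  define Q where "Q i a \<longleftrightarrow> a \<in> P ! i \<and> a \<in> \<Union>(set (drop (Suc i) P))" for i a
  show "card X \<le> r * length P"
  proof (rule card_le_by_index[OF r fin, where Q = Q])
    fix a assume "a \<in> X"
    then have "1 < occ a P" by (rule occ)
    then show "\<exists>i<length P. Q i a"
      unfolding Q_def
    proof (induction P)
      case (Cons B P)
      show ?case
      proof (cases "a \<in> B \<and> 0 < occ a P")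
        case True
        then show ?thesis by (intro exI[of _ 0]) (auto simp: occ_pos)
      next
        case False
        then have "1 < occ a P" using Cons by (auto simp: occ_def split: if_splits)
        then obtain i where "i < length P" "a \<in> P ! i" "a \<in> \<Union>(set (drop (Suc i) P))"
          using Cons.IH by blast
        then show ?thesis by (intro exI[of _ "Suc i"]) auto
      qed
    qed (simp add: occ_def)
  next
    fix i A assume i: "i < length P" and A: "A \<subseteq> {a \<in> X. Q i a}"
    show "card A \<noteq> r"
    proof
      assume "card A = r"
      have "spans A 1 (drop (Suc i) P)"
        using spans_cover_left[of A "drop (Suc i) P" 0 "[]"] A by (auto simp: Q_def)
      then have "spans A 2 ([P ! i] @ drop (Suc i) P)"
        using spans_cover_left[of A "[P ! i]" 1] A by (auto simp: Q_def numeral_2_eq_2)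
      then have "spans A 2 (take i P @ [P ! i] @ drop (Suc i) P)" by (rule spans_append_left)
      moreover have "take i P @ [P ! i] @ drop (Suc i) P = P"
        using id_take_nth_drop[OF i] by simp
      ultimately show False using free[of A] A \<open>card A = r\<close> by auto
    qed
  qed
qed

text \<open>As for order 2, with three factors: the blocks before a given one, the block itself and
  the blocks after it.\<close>

lemma few_symbols_3:
  assumes r: "r \<ge> 1"
  shows "few_symbols TYPE('a) r 3 2 M r"
proof (rule few_symbolsI)
  fix P and X :: "'a set"
  assume fin: "finite X" and occ: "\<And>a. a \<in> X \<Longrightarrow> 2 < occ a P"
    and free: "\<And>A. A \<subseteq> X \<Longrightarrow> card A = r \<Longrightarrow> \<not> spans A 3 P"
  define Q where "Q i a \<longleftrightarrow> a \<in> \<Union>(set (take i P)) \<and> a \<in> P ! i \<and> a \<in> \<Union>(set (drop (Suc i) P))"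
    for i a
  show "card X \<le> r * length P"
  proof (rule card_le_by_index[OF r fin, where Q = Q])
    fix a assume "a \<in> X"
    then have "2 < occ a P" by (rule occ)
    \<comment> \<open>The second occurrence serves: exactly one precedes it, and of more than two
      occurrences one must follow.\<close>
    moreover have "\<exists>i<length P. a \<in> P ! i \<and> occ a (take i P) = Suc 0" if "Suc 0 < occ a P"
      using that
    proof (induction P rule: rev_induct)
      case (snoc B P)
      show ?case
      proof (cases "Suc 0 < occ a P")
        case True
        then obtain i where "i < length P" "a \<in> P ! i" "occ a (take i P) = Suc 0"
          using snoc.IH by blast
        then show ?thesis by (intro exI[of _ i]) (simp add: nth_append)
      next
        case False
        have "occ a (P @ [B]) = occ a P + (if a \<in> B then 1 else 0)" by (simp add: occ_def)
        then have "a \<in> B" "occ a P = Suc 0"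
          using snoc.prems False by (simp_all split: if_splits)
        then show ?thesis by (intro exI[of _ "length P"]) auto
      qed
    qed (simp add: occ_def)
    ultimately obtain i where i: "i < length P" "a \<in> P ! i" "occ a (take i P) = Suc 0"
      by auto
    have "P = take i P @ [P ! i] @ drop (Suc i) P"
      using id_take_nth_drop[OF i(1)] by simp
    then have "occ a P = occ a (take i P) + occ a [P ! i] + occ a (drop (Suc i) P)"
      by (metis add.assoc occ_append)
    then have "0 < occ a (drop (Suc i) P)"
      using \<open>2 < occ a P\<close> i occ_le_length[of a "[P ! i]"] by simp
    then have "Q i a" using i occ_pos[of a "take i P"] by (simp add: Q_def occ_pos)
    then show "\<exists>i<length P. Q i a" using i by auto
  next
    fix i A assume i: "i < length P" and A: "A \<subseteq> {a \<in> X. Q i a}"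
    show "card A \<noteq> r"
    proof
      assume "card A = r"
      have "A \<subseteq> \<Union>(set (take i P))" "A \<subseteq> \<Union>(set [P ! i])" "A \<subseteq> \<Union>(set (drop (Suc i) P @ []))"
        using A by (auto simp: Q_def)
      then have "spans A (Suc (Suc (Suc 0))) (take i P @ [P ! i] @ drop (Suc i) P @ [])"
        using spans_cover_left[of A _ 0 "[]"] by (intro spans_cover_left) simp_all
      then have "spans A 3 (take i P @ [P ! i] @ drop (Suc i) P)"
        by (simp add: numeral_3_eq_3)
      moreover have "take i P @ [P ! i] @ drop (Suc i) P = P"
        using id_take_nth_drop[OF i] by simp
      ultimately show False using free[of A] A \<open>card A = r\<close> by auto
    qed
  qed
qed

section \<open>The Ackermann-like recursion\<close>

lemma ex_parts:
  assumes "0 < t"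
  shows "\<exists>Ps. concat Ps = P \<and> (\<forall>Q\<in>set Ps. length Q \<le> t) \<and> t * length Ps < length P + t"
proof (induction P rule: length_induct)
  case (1 P)
  show ?case
  proof (cases "P = []")
    case True
    then show ?thesis using assms by (intro exI[of _ "[]"]) auto
  next
    case False
    show ?thesis
    proof (cases "length P \<le> t")
      case True
      then show ?thesis using False by (intro exI[of _ "[P]"]) auto
    next
      case long: False
      then have "length (drop t P) < length P" using assms by simp
      then obtain Ps where Ps: "concat Ps = drop t P" "\<forall>Q\<in>set Ps. length Q \<le> t"
        "t * length Ps < length (drop t P) + t" using 1 by blast
      then show ?thesis using long by (intro exI[of _ "take t P # Ps"]) auto
    qed
  qed
qed

text \<open>A symbol that occurs more than \<open>threshold u d\<close> times in a sequence without \<open>(r, u + 2)\<close>-formations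
  can be charged at level \<open>d\<close> of the Ackermann hierarchy; the recursion is the one for the
  threshold in \<open>card_decomposition\<close>.\<close>

fun threshold :: "nat \<Rightarrow> nat \<Rightarrow> nat" where
  "threshold 0 d = 1"
| "threshold (Suc 0) d = 2"
| "threshold (Suc (Suc u)) 0 = 2"
| "threshold (Suc (Suc u)) (Suc d) =
     threshold u (Suc d) * threshold (Suc (Suc u)) d + 2 * threshold (Suc u) (Suc d)"

fun ack :: "nat \<Rightarrow> nat \<Rightarrow> nat" where
  "ack 0 j = j + 2"
| "ack (Suc d) 0 = 2"
| "ack (Suc d) (Suc j) = ack d (ack (Suc d) j)"

lemma threshold_pos: "0 < threshold u d"
  by (induction u d rule: threshold.induct) auto

lemma threshold_mono_Suc: "threshold u d \<le> threshold u (Suc d)"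
proof (cases u rule: nat.exhaust)
  case (Suc v)
  show ?thesis
  proof (cases v)
    case (Suc w)
    then show ?thesis
      using \<open>u = Suc v\<close> threshold_pos[of w "Suc d"] by (cases "threshold w (Suc d)") auto
  qed (use \<open>u = Suc v\<close> in simp)
qed simp

lemma threshold_mono: "d \<le> e \<Longrightarrow> threshold u d \<le> threshold u e"
  using lift_Suc_mono_le[of "threshold u"] threshold_mono_Suc by blast

text \<open>Repeated halving. No symbol meets more than two of two parts, so \<open>R3 = 2\<close>
  and the contracted sequence contributes nothing; this is the origin of the value 2 of
  \<open>threshold\<close> at level 0. Each halving doubles the constant.\<close>

lemma few_symbols_base:
  assumes r: "r \<ge> 1"
  shows "few_symbols TYPE('a) r (u + 2) (threshold u 1) (2 ^ k) (r * 6 ^ u * 2 ^ k)"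
proof (induction u arbitrary: k rule: less_induct)
  case (less u)
  consider "u = 0" | "u = 1" | v where "u = v + 2"
    by (metis One_nat_def add_2_eq_Suc' not0_implies_Suc)
  then show ?case
  proof cases
    case 1
    then have "u + 2 = 2" "threshold u 1 = 1" by simp_all
    then show ?thesis
      by (simp only:) (rule few_symbols_mono[OF few_symbols_2[OF r] _ order_refl], simp_all)
  next
    case 2
    then have "u + 2 = 3" "threshold u 1 = 2" by simp_all
    then show ?thesis
      by (simp only:) (rule few_symbols_mono[OF few_symbols_3[OF r] _ order_refl], simp_all)
  next
    case 3
    define c where "c = r * 6 ^ v"
    show ?thesis
    proof (induction k)
      case 0
      show ?case using threshold_pos[of u 1] by (intro few_symbols_trivial) simp
    next
      case (Suc k)
      show ?case
      proof (rule few_symbolsI)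
        fix P and X :: "'a set"
        assume P: "length P \<le> 2 ^ Suc k" and X: "finite X"
          "\<And>a. a \<in> X \<Longrightarrow> threshold u 1 < occ a P"
          "\<And>A. A \<subseteq> X \<Longrightarrow> card A = r \<Longrightarrow> \<not> spans A (u + 2) P"
        obtain Ps where Ps: "concat Ps = P" "\<forall>Q\<in>set Ps. length Q \<le> 2 ^ k"
          "2 ^ k * length Ps < length P + 2 ^ k" using ex_parts[of "2 ^ k" P] by auto
        have "2 ^ k * length Ps < 2 ^ k * 3" using P Ps(3) unfolding power_Suc by linarith
        then have l: "length Ps \<le> 2" by simp
        have R: "threshold u 1 = 2 * threshold (v + 1) 1 + threshold v 1 * 2" using 3 by simp
        have "card X \<le> (c * 36 * 2 ^ k + 2 * (c * 6 * 2 ^ k) + c * 2 ^ k) * length (concat Ps)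
            + 0 * length Ps"
        proof (rule card_decomposition[where s = "v + 2"])
          show "few_symbols TYPE('a) r (v + 2 + 2) (2 * threshold (v + 1) 1 + threshold v 1 * 2) (2 ^ k) (c * 36 * 2 ^ k)"
            using Suc.IH unfolding R[symmetric] 3 by (simp add: c_def mult_ac)
          show "few_symbols TYPE('a) r (v + 2 + 1) (threshold (v + 1) 1) (2 ^ k) (c * 6 * 2 ^ k)"
            using less.IH[of "v + 1" k] 3 by (simp add: c_def mult_ac)
          show "few_symbols TYPE('a) r (v + 2) (threshold v 1) (2 ^ k) (c * 2 ^ k)"
            using less.IH[of v k] 3 by (simp add: c_def)
          show "few_symbols TYPE('a) r (v + 2 + 2) 2 (length Ps) 0"
            by (rule few_symbols_trivial[OF l])
          show "2 * threshold (v + 1) 1 + threshold v 1 * 2 < occ a (concat Ps)" if "a \<in> X" for a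
            using X(2)[OF that] unfolding R Ps(1) .
          show "\<not> spans A (v + 2 + 2) (concat Ps)" if "A \<subseteq> X" "card A = r" for A
            using X(3)[OF that] unfolding 3 Ps(1) .
        qed (use Ps X in auto)
        \<comment> \<open>The base 6 leaves room for the lower orders:
          \<open>36 + 2 * 6 + 1 \<le> 2 * 36\<close>.\<close>
        also have "\<dots> \<le> (c * 36 * 2 ^ Suc k) * length P"
          unfolding Ps(1) mult_0 add_0_right by (intro mult_right_mono) simp_all
        finally show "card X \<le> (r * 6 ^ u * 2 ^ Suc k) * length P"
          using 3 by (simp add: c_def mult_ac)
      qed
    qed
  qed
qed

text \<open>The constant depends on \<open>j\<close> but not on the level. With
  \<open>i = ack (Suc d) j\<close>, parts of length at most \<open>4 * 2 ^ i\<close> are handled by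
  the same level at \<open>j\<close>, and their contraction by level \<open>d\<close> at
  \<open>i\<close>, because \<open>ack (Suc d) (Suc j) = ack d i\<close>. The latter costs a factor
  \<open>2 ^ i\<close>, but there are only about \<open>length P / 2 ^ i\<close> parts, so it
  cancels. The index of \<open>threshold\<close> is one ahead of that of \<open>ack\<close>, as its
  index 0 belongs to the contraction to two blocks.\<close>

lemma few_symbols_level:
  assumes r: "r \<ge> 1"
  shows "few_symbols TYPE('a) r (u + 2) (threshold u (Suc d)) (4 * 2 ^ ack d j) (16 * r * 6 ^ u * 2 ^ j)"
proof (induction u arbitrary: d j rule: less_induct)
  case (less u)
  \<comment> \<open>The factor 16 stems from \<open>4 * 2 ^ (j + 2) = 16 * 2 ^ j\<close>. This
    settles \<open>ack 0 j = j + 2\<close> and also \<open>ack (Suc d) 0 = 2\<close>.\<close>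
  have base: "few_symbols TYPE('a) r (u + 2) (threshold u (Suc d)) (4 * 2 ^ (j + 2)) (16 * r * 6 ^ u * 2 ^ j)" for d j
    using few_symbols_base[OF r, where u = u and k = "j + 4"]
    by (rule few_symbols_mono) (simp_all add: power_add threshold_mono)
  consider "u = 0" | "u = 1" | v where "u = v + 2"
    by (metis One_nat_def add_2_eq_Suc' not0_implies_Suc)
  then show ?case
  proof cases
    case 1
    then have "u + 2 = 2" "threshold u (Suc d) = 1" by simp_all
    then show ?thesis
      by (simp only:) (rule few_symbols_mono[OF few_symbols_2[OF r] _ order_refl], simp_all)
  next
    case 2
    then have "u + 2 = 3" "threshold u (Suc d) = 2" by simp_all
    then show ?thesis
      by (simp only:) (rule few_symbols_mono[OF few_symbols_3[OF r] _ order_refl], simp_all)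
  next
    case 3
    define c where "c = 16 * r * 6 ^ v"
    show ?thesis
    proof (induction d j rule: ack.induct)
      case (1 j)
      show ?case using base by simp
    next
      case (2 d)
      show ?case using base[of "Suc d" 0] by simp
    next
      case (3 d j)
      define i where "i = ack (Suc d) j"
      define t :: nat where "t = 4 * 2 ^ i"
      have t: "0 < t" by (simp add: t_def)
      note u = \<open>u = v + 2\<close>
      have IH1: "few_symbols TYPE('a) r (u + 2) (threshold u (Suc (Suc d))) t (c * 36 * 2 ^ j)"
        using 3(1) unfolding i_def t_def by (simp add: c_def u mult_ac)
      have IH2: "few_symbols TYPE('a) r (u + 2) (threshold u (Suc d)) (4 * 2 ^ ack d i) (c * 36 * 2 ^ i)"
        using 3(2) unfolding i_def by (simp add: c_def u mult_ac)
      show ?case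
      proof (rule few_symbolsI)
        fix P and X :: "'a set"
        assume P: "length P \<le> 4 * 2 ^ ack (Suc d) (Suc j)" and X: "finite X"
          "\<And>a. a \<in> X \<Longrightarrow> threshold u (Suc (Suc d)) < occ a P"
          "\<And>A. A \<subseteq> X \<Longrightarrow> card A = r \<Longrightarrow> \<not> spans A (u + 2) P"
        have goal: "16 * r * 6 ^ u * 2 ^ Suc j = c * 36 * 2 ^ j + c * 36 * 2 ^ j"
          by (simp add: c_def u mult_ac)
        show "card X \<le> 16 * r * 6 ^ u * 2 ^ Suc j * length P"
        proof (cases "length P \<le> t")
          case True
          then have "card X \<le> c * 36 * 2 ^ j * length P"
            by (rule few_symbolsD[OF IH1 _ X])
          then show ?thesis unfolding goal by (simp add: algebra_simps)
        next
          case False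
          obtain Ps where Ps: "concat Ps = P" "\<forall>Q\<in>set Ps. length Q \<le> t"
            "t * length Ps < length P + t" using ex_parts[OF t, of P] by auto
          \<comment> \<open>Since \<open>P\<close> is longer than \<open>t\<close>, rounding up the
            number of parts at most doubles it.\<close>
          have l: "t * length Ps \<le> 2 * length P" using Ps(3) False by simp
          then have l2: "2 * 2 ^ i * length Ps \<le> length P" by (simp add: t_def mult_ac)
          have "length Ps \<le> 2 * 2 ^ i * length Ps" by simp
          then have len: "length Ps \<le> 4 * 2 ^ ack d i"
            using l2 P unfolding i_def ack.simps by linarith
          have R: "threshold u (Suc (Suc d)) = 2 * threshold (v + 1) (Suc (Suc d)) + threshold v (Suc (Suc d)) * threshold u (Suc d)"
            using u by simp
          have "card X \<le> (c * 36 * 2 ^ j + 2 * (c * 6 * 2 ^ j) + c * 2 ^ j) * length (concat Ps)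
            + c * 36 * 2 ^ i * length Ps"
          proof (rule card_decomposition[where s = "v + 2"])
            show "few_symbols TYPE('a) r (v + 2 + 2)
               (2 * threshold (v + 1) (Suc (Suc d)) + threshold v (Suc (Suc d)) * threshold u (Suc d)) t (c * 36 * 2 ^ j)"
              using IH1 unfolding R[symmetric] unfolding u .
            show "few_symbols TYPE('a) r (v + 2 + 1) (threshold (v + 1) (Suc (Suc d))) t (c * 6 * 2 ^ j)"
              using less.IH[of "v + 1" "Suc d" j] u by (simp add: c_def mult_ac t_def i_def)
            show "few_symbols TYPE('a) r (v + 2) (threshold v (Suc (Suc d))) t (c * 2 ^ j)"
              using less.IH[of v "Suc d" j] u by (simp add: c_def t_def i_def)
            show "few_symbols TYPE('a) r (v + 2 + 2) (threshold u (Suc d)) (length Ps) (c * 36 * 2 ^ i)"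
              using few_symbols_mono[OF IH2 order_refl len order_refl] u by simp
            show "2 * threshold (v + 1) (Suc (Suc d)) + threshold v (Suc (Suc d)) * threshold u (Suc d)
                < occ a (concat Ps)" if "a \<in> X" for a
              using X(2)[OF that] unfolding R Ps(1) .
            show "\<not> spans A (v + 2 + 2) (concat Ps)" if "A \<subseteq> X" "card A = r" for A
              using X(3)[OF that] unfolding u Ps(1) .
          qed (use Ps X in auto)
          \<comment> \<open>The contraction adds 18, and
            \<open>36 + 2 * 6 + 1 + 18 \<le> 2 * 36\<close> still holds.\<close>
          also have "c * 36 * 2 ^ i * length Ps \<le> c * 18 * length P"
            using mult_left_mono[OF l2, of "c * 18"] by (simp add: mult.assoc)
          also have "c * 18 * length P \<le> c * 18 * 2 ^ j * length P" by simp
          finally show ?thesis unfolding goal Ps(1) by (simp add: algebra_simps)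
        qed
      qed
    qed
  qed
qed

text \<open>One unfolding of \<open>alpha_k\<close> matches one unfolding of \<open>ack\<close>. The
  lemma is applied with \<open>j = 3\<close>, the bound in the definition of the inverse Ackermann
  function.\<close>

lemma le_ack_alpha_k:
  "1 \<le> k \<Longrightarrow> alpha_k k x \<le> j \<Longrightarrow> x \<le> ack k j"
proof (induction k x arbitrary: j rule: alpha_k.induct)
  case (2 x)
  have "ack (Suc 0) j = 2 * j + 2" for j by (induction j) auto
  moreover have "x \<le> 2 * j" using "2.prems" by simp
  ultimately show ?case by simp
next
  case (3 k x)
  show ?case
  proof (cases "x \<le> 1")
    case True
    have "2 \<le> ack l i" for l i by (induction l i rule: ack.induct) auto
    then show ?thesis using True by (meson one_le_numeral order_trans)
  next
    case False
    then obtain i where i: "j = Suc i" "alpha_k (Suc (Suc k)) (alpha_k (Suc k) x) \<le> i"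
      using "3.prems" by (cases j) auto
    then have "alpha_k (Suc k) x \<le> ack (Suc (Suc k)) i" using 3(2)[OF False] by simp
    then have "x \<le> ack (Suc k) (ack (Suc (Suc k)) i)" using 3(1)[OF False] by simp
    then show ?thesis using i by simp
  qed
qed simp

section \<open>From sequences to block sequences\<close>

lemma occ_take_mono: "i \<le> j \<Longrightarrow> occ a (take i P) \<le> occ a (take j P)"
  by (metis le_add1 le_add_diff_inverse occ_append take_add)

lemma occ_take_less:
  assumes "i < j" "i < length P" "a \<in> P ! i"
  shows "occ a (take i P) < occ a (take j P)"
proof -
  have "occ a (take (Suc i) P) = Suc (occ a (take i P))"
    using assms by (simp add: take_Suc_conv_app_nth) (simp add: occ_def)
  then show ?thesis using occ_take_mono[of "Suc i" j a P] assms(1) by simp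
qed

lemma bij_betw_rank:
  "bij_betw (\<lambda>i. occ a (take i P)) {i. i < length P \<and> a \<in> P ! i} {..<occ a P}"
proof -
  let ?I = "{i. i < length P \<and> a \<in> P ! i}" and ?f = "\<lambda>i. occ a (take i P)"
  have inj: "inj_on ?f ?I"
  proof (rule linorder_inj_onI)
    show "?f i \<noteq> ?f j" if "i < j" "i \<in> ?I" for i j
      using occ_take_less[of i j P a] that by auto
  qed auto
  moreover have "?f ` ?I \<subseteq> {..<occ a P}"
    using occ_take_less[of _ "length P" P a] by auto
  moreover have "card (?f ` ?I) = occ a P"
    using card_image[OF inj] by (simp add: occ_conv_card)
  ultimately show ?thesis unfolding bij_betw_def by (simp add: card_subset_eq)
qed

text \<open>The occurrences of each symbol are grouped, in order, into groups of \<open>R + 1\<close>, and each group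
  becomes a new symbol. Two groups of one symbol do not interleave, so the symbols of a formation
  of order at least 2 stay distinct when the groups are forgotten.\<close>

lemma sum_occ_le:
  fixes P :: "'a set list"
  assumes few: "few_symbols TYPE('a \<times> nat) r (s + 2) R M c"
    and len: "length P \<le> M" and fin: "finite (\<Union>(set P))"
    and free: "\<And>A. A \<subseteq> \<Union>(set P) \<Longrightarrow> card A = r \<Longrightarrow> \<not> spans A (s + 2) P"
  shows "(\<Sum>a\<in>\<Union>(set P). occ a P) \<le> Suc R * (c * length P + card (\<Union>(set P)))"
proof -
  define q where "q = Suc R"
  have q: "0 < q" by (simp add: q_def)
  define U where "U = \<Union>(set P)"
  define g where "g i a = occ a (take i P) div q" for i a
  define P' where "P' = map (\<lambda>i. (\<lambda>a. (a, g i a)) ` (P ! i)) [0..<length P]"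
  \<comment> \<open>Only complete groups count. The remainder, fewer than \<open>q\<close>
    occurrences per symbol, yields the second summand of the bound.\<close>
  define X where "X = (SIGMA a:U. {..<occ a P div q})"
  have lenP': "length P' = length P" by (simp add: P'_def)
  have nthP': "P' ! i = (\<lambda>a. (a, g i a)) ` (P ! i)" if "i < length P" for i
    using that by (simp add: P'_def)
  have occX: "R < occ x P'" if "x \<in> X" for x
  proof -
    obtain a k where x: "x = (a, k)" by (cases x)
    then have k: "k < occ a P div q" using that by (simp add: X_def)
    let ?f = "\<lambda>i. occ a (take i P)"
    let ?J = "{i. i < length P \<and> a \<in> P ! i \<and> ?f i div q = k}"
    have "Suc k \<le> occ a P div q" using k by simp
    then have "Suc k * q \<le> occ a P div q * q" by (rule mult_right_mono) simp
    also have "\<dots> \<le> occ a P" by simp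
    finally have le: "k * q + q \<le> occ a P" by simp
    have "{k * q..<k * q + q} \<subseteq> ?f ` ?J"
    proof
      fix n assume n: "n \<in> {k * q..<k * q + q}"
      then have "n div q = k" using q by (intro div_nat_eqI) (auto simp: mult.commute)
      moreover have "n \<in> {..<occ a P}" using n le by simp
      then obtain i where "i < length P" "a \<in> P ! i" "n = ?f i"
        using bij_betw_imp_surj_on[OF bij_betw_rank[of a P]] by blast
      ultimately show "n \<in> ?f ` ?J" by auto
    qed
    then have "card {k * q..<k * q + q} \<le> card (?f ` ?J)" by (intro card_mono) auto
    also have "\<dots> \<le> card ?J" by (rule card_image_le) simp
    also have "?J = {i. i < length P' \<and> x \<in> P' ! i}"
      using x by (auto simp: lenP' nthP' g_def)
    finally show ?thesis by (simp add: occ_conv_card q_def)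
  qed
  \<comment> \<open>Group \<open>k'\<close> occurs in the first factor and group \<open>k\<close> in
    the second, so \<open>k'\<close> is not the later one. Exchanging them gives equality.\<close>
  have g_le: "k' \<le> k" if sp: "spans A (s + 2) P'" and k: "(a, k) \<in> A" and k': "(a, k') \<in> A" for A a k k'
  proof -
    have "spans A (Suc (Suc s)) P'" using sp by simp
    then obtain C1 C2 Q where C: "P' = C1 @ C2 @ Q" "A \<subseteq> \<Union>(set C1)" "A \<subseteq> \<Union>(set C2)"
      unfolding spans.simps by blast
    obtain i where i: "i < length C1" "(a, k') \<in> C1 ! i"
      using subsetD[OF C(2) k'] by (auto simp: in_set_conv_nth)
    obtain j where j: "j < length C2" "(a, k) \<in> C2 ! j"
      using subsetD[OF C(3) k] by (auto simp: in_set_conv_nth)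
    have l: "i < length P" "length C1 + j < length P"
      using i j C(1) lenP' by auto
    have "C1 ! i = P' ! i" "C2 ! j = P' ! (length C1 + j)" using i j C(1) by (auto simp: nth_append)
    then have "k' = g i a" "k = g (length C1 + j) a" using i j nthP' l by auto
    then show ?thesis using occ_take_mono[of i "length C1 + j" a P] i by (simp add: g_def div_le_mono)
  qed
  have "card X \<le> c * length P'"
  proof (rule few_symbolsD[OF few])
    show "length P' \<le> M" using len lenP' by simp
    show "finite X" using fin by (simp add: X_def U_def)
    fix A assume A: "A \<subseteq> X" "card A = r"
    show "\<not> spans A (s + 2) P'"
    proof
      assume sp: "spans A (s + 2) P'"
      have "inj_on fst A"
        using g_le[OF sp] by (auto simp: inj_on_def intro: antisym)
      then have "card (fst ` A) = r" using A(2) by (simp add: card_image)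
      moreover have "fst ` A \<subseteq> \<Union>(set P)" using A(1) by (fastforce simp: X_def U_def)
      moreover have "spans (fst ` A) (s + 2) P"
        by (rule spans_image[OF _ sp]) (auto simp: list_all2_conv_all_nth lenP' nthP')
      ultimately show False using free by blast
    qed
  qed (rule occX)
  then have "(\<Sum>a\<in>U. occ a P div q) \<le> c * length P"
    using fin by (simp add: X_def card_SigmaI U_def lenP')
  then have le: "q * (\<Sum>a\<in>U. occ a P div q) \<le> q * (c * length P)" by (rule mult_le_mono2)
  have "occ a P \<le> q * (occ a P div q) + q" for a
    using mult_div_mod_eq[of q "occ a P"] mod_less_divisor[OF q, of "occ a P"] by linarith
  then have "(\<Sum>a\<in>U. occ a P) \<le> (\<Sum>a\<in>U. q * (occ a P div q) + q)" by (intro sum_mono)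
  also have "\<dots> = q * (\<Sum>a\<in>U. occ a P div q) + card U * q"
    by (simp add: sum.distrib sum_distrib_left)
  finally have "(\<Sum>a\<in>U. occ a P) \<le> q * (c * length P) + card U * q" using le by linarith
  then show ?thesis by (simp add: q_def U_def algebra_simps)
qed

lemma sum_occ_eq:
  assumes "finite U" "\<And>B. B \<in> set P \<Longrightarrow> B \<subseteq> U"
  shows "(\<Sum>a\<in>U. occ a P) = sum_list (map card P)"
  using assms(2)
proof (induction P)
  case (Cons B P)
  have "occ a (B # P) = (if a \<in> B then 1 else 0) + occ a P" for a by (simp add: occ_def)
  moreover have "U \<inter> B = B" using Cons.prems by auto
  ultimately show ?case using Cons assms(1) by (simp add: sum.distrib sum.If_cases)
qed (simp add: occ_def)

section \<open>Formations in sequences and in blocks\<close>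

lemma ex_permutation_subseq:
  "A \<subseteq> set xs \<Longrightarrow> \<exists>p\<in>permutations_of_set A. subseq p xs"
proof (induction xs arbitrary: A)
  case (Cons x xs)
  show ?case
  proof (cases "x \<in> A")
    case True
    then obtain p where "p \<in> permutations_of_set (A - {x})" "subseq p xs"
      using Cons.IH[of "A - {x}"] Cons.prems by auto
    then show ?thesis using True
      by (intro bexI[of _ "x # p"]) (auto simp: permutations_of_set_def)
  next
    case False
    then obtain p where "p \<in> permutations_of_set A" "subseq p xs"
      using Cons by (metis subset_insert list.simps(15))
    then show ?thesis by (intro bexI[of _ p]) auto
  qed
qed (auto simp: permutations_of_set_def)

text \<open>The permutations of a formation need not agree, so each factor may supply the symbols of
  \<open>A\<close> in whatever order it offers.\<close>

lemma spans_imp_subseq: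
  assumes "spans A s (map set Ts)"
  shows "\<exists>ps. length ps = s \<and> set ps \<subseteq> permutations_of_set A \<and> subseq (concat ps) (concat Ts)"
  using assms
proof (induction s arbitrary: Ts)
  case (Suc s)
  then obtain C Q where *: "map set Ts = C @ Q" "A \<subseteq> \<Union>(set C)" "spans A s Q"
    unfolding spans.simps by blast
  then obtain Cs Qs where Cs: "Ts = Cs @ Qs" "C = map set Cs" "Q = map set Qs"
    by (auto simp: map_eq_append_conv)
  have "A \<subseteq> set (concat Cs)" using * Cs by auto
  then obtain p where p: "p \<in> permutations_of_set A" "subseq p (concat Cs)"
    using ex_permutation_subseq by blast
  obtain ps where "length ps = s" "set ps \<subseteq> permutations_of_set A" "subseq (concat ps) (concat Qs)"
    using Suc.IH[of Qs] *(3) Cs(3) by auto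
  then show ?case using p Cs(1)
    by (intro exI[of _ "p # ps"]) (auto intro: list_emb_append_mono)
qed simp

lemma not_spans_map_set:
  assumes "\<not> contains_formation r s (concat Ts)" "1 \<le> r" "card A = r"
  shows "\<not> spans A s (map set Ts)"
proof
  assume "spans A s (map set Ts)"
  moreover have "finite A" using assms by (metis card.infinite not_one_le_zero)
  ultimately show False
    using spans_imp_subseq[of A s Ts] assms unfolding contains_formation_def is_formation_def by blast
qed

lemma contains_formation_Suc:
  assumes "contains_formation r (Suc s) S" shows "contains_formation r s S"
proof -
  obtain A ps where *: "finite A" "card A = r" "length ps = Suc s"
    "set ps \<subseteq> permutations_of_set A" "subseq (concat ps) S"
    using assms unfolding contains_formation_def is_formation_def by blast
  obtain p qs where ps: "ps = p # qs" using *(3) by (cases ps) auto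
  have "subseq (concat qs) (concat ps)" by (simp add: ps list_emb_append2)
  then have "subseq (concat qs) S" using *(5) by (rule subseq_order.trans)
  then show ?thesis using * ps unfolding contains_formation_def is_formation_def by auto
qed

lemma contains_formation_surround:
  assumes "contains_formation r s T" "set T \<subseteq> set X" "set T \<subseteq> set Y" "1 \<le> s"
  shows "contains_formation r (s + 2) (X @ T @ Y)"
proof -
  obtain A ps where *: "finite A" "card A = r" "length ps = s"
    "set ps \<subseteq> permutations_of_set A" "subseq (concat ps) T"
    using assms(1) unfolding contains_formation_def is_formation_def by blast
  \<comment> \<open>As \<open>1 \<le> s\<close>, a whole permutation of \<open>A\<close> lies in
    \<open>T\<close>; hence \<open>A\<close> also lies in \<open>X\<close> and in
    \<open>Y\<close>.\<close>
  obtain p where "p \<in> set ps" using *(3) assms(4) by (cases ps) auto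
  then have "A \<subseteq> set (concat ps)" using *(4) by (auto simp: permutations_of_set_def)
  also have "\<dots> \<subseteq> set T" using *(5) by (metis notin_set_nthsI subseq_conv_nths subsetI)
  finally have A: "A \<subseteq> set T" .
  obtain p q where "p \<in> permutations_of_set A" "subseq p X" "q \<in> permutations_of_set A" "subseq q Y"
    using ex_permutation_subseq[of A] A assms(2,3) by (metis order_trans)
  then have "length (p # ps @ [q]) = s + 2" "set (p # ps @ [q]) \<subseteq> permutations_of_set A"
    "subseq (concat (p # ps @ [q])) (X @ T @ Y)"
    using * by (auto intro!: list_emb_append_mono)
  then show ?thesis using * unfolding contains_formation_def is_formation_def by blast
qed

lemma sparse_factor:
  assumes "sparse r (X @ T @ Y)" shows "sparse r T"
  unfolding sparse_def
proof (intro allI impI)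
  fix i j assume ij: "i < length T" "j < length T" "1 \<le> \<bar>int i - int j\<bar> \<and> \<bar>int i - int j\<bar> \<le> int r - 1"
  let ?i = "length X + i" and ?j = "length X + j"
  have "?i < length (X @ T @ Y)" "?j < length (X @ T @ Y)"
    "1 \<le> \<bar>int ?i - int ?j\<bar> \<and> \<bar>int ?i - int ?j\<bar> \<le> int r - 1" using ij by auto
  then have "(X @ T @ Y) ! ?i \<noteq> (X @ T @ Y) ! ?j" using assms unfolding sparse_def by blast
  then show "T ! i \<noteq> T ! j" using ij by (simp add: nth_append)
qed

text \<open>Greedy chunks: a chunk that stops just after completing an \<open>(r, s)\<close>-formation contains the
  first or the last occurrence of some symbol, as otherwise the formation extends by two
  permutations.\<close>

lemma ex_chunks:
  fixes S :: "'a list"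
  assumes free: "\<not> contains_formation r (s + 2) S" and r: "1 \<le> r" and s: "1 \<le> s"
    and W: "\<And>X T Y. S = X @ T @ Y \<Longrightarrow> \<not> contains_formation r s T \<Longrightarrow> length T \<le> W * card (set T)"
    and S: "S = X @ Z"
  shows "\<exists>Ts. concat Ts = Z \<and> length Ts \<le> card (set Z - set X) + card (set Z) + 1 \<and>
    (\<forall>T\<in>set Ts. length T \<le> Suc W * card (set T))"
  using S
proof (induction "length Z" arbitrary: X Z rule: less_induct)
  case less
  show ?case
  proof (cases "contains_formation r s Z")
    case False
    then have "length Z \<le> W * card (set Z)" using W[of X Z "[]"] less.prems by simp
    then show ?thesis by (intro exI[of _ "[Z]"]) auto
  next
    case True
    define k where "k = (LEAST k. contains_formation r s (take k Z))"
    have ex: "contains_formation r s (take (length Z) Z)" using True by simp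
    have k: "contains_formation r s (take k Z)" unfolding k_def by (rule LeastI[where P = "\<lambda>k. contains_formation r s (take k Z)", OF ex])
    have k_le: "k \<le> length Z" unfolding k_def by (rule Least_le[where P = "\<lambda>k. contains_formation r s (take k Z)", OF ex])
    have "\<not> contains_formation r s ([] :: 'a list)"
    proof
      assume "contains_formation r s ([] :: 'a list)"
      then obtain A ps where *: "card A = r" "length ps = s" "set ps \<subseteq> permutations_of_set A"
        "subseq (concat ps) ([] :: 'a list)"
        unfolding contains_formation_def is_formation_def by blast
      have "concat ps = []" using list_emb_Nil2[OF *(4)] .
      obtain p qs where "ps = p # qs" using *(2) s by (cases ps) auto
      with \<open>concat ps = []\<close> have "A = {}" using *(3) by (auto simp: permutations_of_set_def)
      then show False using * r by simp
    qed
    then obtain k' where k': "k = Suc k'" using k by (cases k) auto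
    have u: "\<not> contains_formation r s (take k' Z)"
      using not_less_Least[of k' "\<lambda>k. contains_formation r s (take k Z)"] k' by (simp add: k_def)
    define T Z' where "T = take k Z" and "Z' = drop k Z"
    have Z: "Z = T @ Z'" by (simp add: T_def Z'_def)
    \<comment> \<open>Without its last symbol the chunk is free and \<open>W\<close> applies. The
      last symbol adds 1, at most \<open>card (set T)\<close>, whence \<open>Suc W\<close>.\<close>
    have "length (take k' Z) \<le> W * card (set (take k' Z))"
      using W[of X "take k' Z" "drop k' Z"] u less.prems by simp
    also have "\<dots> \<le> W * card (set T)"
      unfolding T_def k' by (intro mult_left_mono card_mono set_take_subset_set_take) auto
    finally have "length T \<le> W * card (set T) + 1" using k' k_le by (simp add: T_def)
    moreover have "0 < card (set T)" using k' k_le by (auto simp: T_def card_gt_0_iff)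
    ultimately have T: "length T \<le> Suc W * card (set T)" by simp
    have "length Z' < length Z" using k' k_le by (simp add: Z'_def)
    moreover have S': "S = (X @ T) @ Z'" using less.prems Z by simp
    ultimately obtain Ts where Ts: "concat Ts = Z'"
      "length Ts \<le> card (set Z' - set (X @ T)) + card (set Z') + 1"
      "\<forall>T\<in>set Ts. length T \<le> Suc W * card (set T)"
      using less.hyps by blast
    have le: "card (set Z' - set (X @ T)) \<le> card (set Z - set X)" "card (set Z') \<le> card (set Z)"
      using Z by (auto intro!: card_mono)
    \<comment> \<open>The potential counts the symbols whose first occurrence is still to come and
      those whose last one is. If it does not drop, every symbol of \<open>T\<close> occurs both
      before and after \<open>T\<close>.\<close>
    have "card (set Z' - set (X @ T)) + card (set Z') < card (set Z - set X) + card (set Z)"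
    proof (rule ccontr)
      assume "\<not> ?thesis"
      then have eq: "card (set Z' - set (X @ T)) = card (set Z - set X)" "card (set Z') = card (set Z)"
        using le by auto
      have "set Z' = set Z" using eq(2) Z by (intro card_subset_eq) auto
      moreover have "set Z' - set (X @ T) = set Z - set X"
        using eq(1) Z by (intro card_subset_eq) auto
      ultimately have "set T \<subseteq> set X" "set T \<subseteq> set Z'" using Z by auto
      then have "contains_formation r (s + 2) (X @ T @ Z')"
        using k s by (intro contains_formation_surround) (auto simp: T_def)
      then show False using free S' by simp
    qed
    then show ?thesis using Ts T Z by (intro exI[of _ "T # Ts"]) auto
  qed
qed

text \<open>Chunks become blocks. A chunk is at most \<open>Suc W\<close> times as long as its block
  is large, so it suffices to bound the total size of the blocks, which is the total number of
  occurrences.\<close>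

lemma length_le_chunk_bound:
  fixes S :: "'a list"
  assumes free: "\<not> contains_formation r (u + 2) S" and r: "1 \<le> r" and u: "1 \<le> u"
    and W: "\<And>X T Y. S = X @ T @ Y \<Longrightarrow> \<not> contains_formation r u T \<Longrightarrow> length T \<le> W * card (set T)"
    and n: "card (set S) \<le> ack d 3"
  shows "length S \<le> Suc W * (Suc (threshold u (Suc d)) * (Suc (384 * r * 6 ^ u) * card (set S)))"
proof (cases "S = []")
  case False
  define n c where "n = card (set S)" and "c = 128 * r * 6 ^ u"
  have n0: "1 \<le> n" using False by (simp add: n_def Suc_le_eq card_gt_0_iff)
  obtain Ts where Ts: "concat Ts = S" "length Ts \<le> n + n + 1"
    "\<And>T. T \<in> set Ts \<Longrightarrow> length T \<le> Suc W * card (set T)"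
  proof -
    have "\<exists>Ts. concat Ts = S \<and> length Ts \<le> card (set S - set ([] :: 'a list)) + card (set S) + 1 \<and>
        (\<forall>T\<in>set Ts. length T \<le> Suc W * card (set T))"
      by (rule ex_chunks[OF free r u]) (rule W, assumption+, simp)
    then show ?thesis using that by (auto simp: n_def)
  qed
  define P where "P = map set Ts"
  have U: "\<Union>(set P) = set S" using Ts(1) by (auto simp: P_def)
  have "n < 2 ^ n" by (rule less_exp)
  also have "(2::nat) ^ n \<le> 2 ^ ack d 3" using n by (intro power_increasing) (auto simp: n_def)
  finally have len: "length P \<le> 4 * 2 ^ ack d 3" using Ts(2) by (simp add: P_def)
  have "few_symbols TYPE('a \<times> nat) r (u + 2) (threshold u (Suc d)) (4 * 2 ^ ack d 3) c"
    using few_symbols_level[OF r, of u d 3, where 'a = "'a \<times> nat"] by (simp add: c_def mult_ac)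
  then have "(\<Sum>a\<in>\<Union>(set P). occ a P) \<le>
      Suc (threshold u (Suc d)) * (c * length P + card (\<Union>(set P)))"
  proof (rule sum_occ_le[OF _ len])
    show "finite (\<Union>(set P))" unfolding U by simp
    show "\<not> spans A (u + 2) P" if "card A = r" for A
      using not_spans_map_set[OF _ r that] free unfolding P_def by (simp add: Ts(1))
  qed
  also have "(\<Sum>a\<in>\<Union>(set P). occ a P) = sum_list (map (\<lambda>T. card (set T)) Ts)"
    using sum_occ_eq[of "\<Union>(set P)" P] U by (force simp: P_def comp_def)
  finally have total: "sum_list (map (\<lambda>T. card (set T)) Ts) \<le>
      Suc (threshold u (Suc d)) * (c * length P + n)" by (simp add: U n_def)
  \<comment> \<open>Here \<open>2 * n + 1 \<le> 3 * n\<close>. The constants are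
    \<open>128 = 16 * 2 ^ 3\<close>, from \<open>j = 3\<close>, and
    \<open>384 = 3 * 128\<close>.\<close>
  have "length P \<le> 3 * n" using Ts(2) n0 by (simp add: P_def)
  then have "c * length P + n \<le> c * (3 * n) + n" by simp
  also have "\<dots> = Suc (384 * r * 6 ^ u) * n" by (simp add: c_def)
  finally have total': "sum_list (map (\<lambda>T. card (set T)) Ts) \<le>
      Suc (threshold u (Suc d)) * (Suc (384 * r * 6 ^ u) * n)"
    using total by (meson mult_left_mono order_trans zero_le)
  have "length S = sum_list (map length Ts)" using Ts(1) length_concat by blast
  also have "\<dots> \<le> sum_list (map (\<lambda>T. Suc W * card (set T)) Ts)" by (intro sum_list_mono Ts(3))
  also have "\<dots> = Suc W * sum_list (map (\<lambda>T. card (set T)) Ts)" by (rule sum_list_const_mult)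
  also have "\<dots> \<le> Suc W * (Suc (threshold u (Suc d)) * (Suc (384 * r * 6 ^ u) * n))"
    by (intro mult_left_mono total') simp
  finally show ?thesis unfolding n_def .
qed simp

text \<open>The index is the order minus 2. Each descent by two orders to the chunks costs one
  threshold as a factor, until order 2 or 3 is reached, where lengths are linear.\<close>

fun weight :: "nat \<Rightarrow> nat \<Rightarrow> nat" where
  "weight 0 d = 1"
| "weight (Suc 0) d = 1"
| "weight (Suc (Suc u)) d = weight u d * threshold (Suc (Suc u)) (Suc d)"

lemma weight_pos: "0 < weight u d"
  by (induction u d rule: weight.induct) (auto simp: threshold_pos)

text \<open>Sparsity starts the induction: \<open>r\<close> consecutive symbols are distinct and
  thus form an \<open>(r, 1)\<close>-formation, so the length is below \<open>r\<close>.\<close>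

lemma length_le_no_1_formation:
  assumes "sparse r T" "\<not> contains_formation r 1 T" "1 \<le> r"
  shows "length T \<le> r * card (set T)"
proof -
  have "length T < r"
  proof (rule ccontr)
    assume "\<not> ?thesis"
    then have *: "distinct (take r T)" "length (take r T) = r"
      using sparse_block_distinct[OF assms(1), of 0] by auto
    have "card (set (take r T)) = r" using distinct_card[OF *(1)] *(2) by simp
    moreover have "take r T \<in> permutations_of_set (set (take r T))"
      using * by (auto simp: permutations_of_set_def)
    ultimately have "is_formation r 1 (take r T)"
      unfolding is_formation_def
      by (intro exI[of _ "set (take r T)"] exI[of _ "[take r T]"]) auto
    moreover have "subseq (take r T) T" by (meson prefix_imp_subseq take_is_prefix)
    ultimately show False using assms(2) unfolding contains_formation_def by blast
  qed
  moreover have "0 < card (set T) \<or> T = []" by (cases T) (auto simp: card_gt_0_iff)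
  ultimately show ?thesis by (cases "card (set T)") auto
qed

lemma formation_free_length_3:
  fixes S :: "'a list"
  assumes "sparse r S" "\<not> contains_formation r 3 S" "card (set S) \<le> ack d 3" and r: "1 \<le> r"
  shows "length S \<le> Suc r * (3 * (Suc (384 * r * 6) * card (set S)))"
proof -
  have "length T \<le> r * card (set T)" if "S = X @ T @ Y" "\<not> contains_formation r 1 T" for X T Y
    using length_le_no_1_formation[OF _ that(2) r] sparse_factor[of r X T Y] assms(1) that(1) by simp
  moreover have "\<not> contains_formation r (1 + 2) S" using assms(2) by (simp add: numeral_3_eq_3)
  ultimately have "length S \<le> Suc r * (Suc (threshold 1 (Suc d)) * (Suc (384 * r * 6 ^ 1) * card (set S)))"
    by (intro length_le_chunk_bound[OF _ r _ _ assms(3)]) simp_all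
  moreover have "Suc (threshold 1 (Suc d)) = 3" by simp
  ultimately show ?thesis by (simp only: power_one_right)
qed

text \<open>\<open>C\<close> is chosen before \<open>d\<close>, which will grow with the number of
  symbols. A chunk has no more symbols than the whole sequence, so the same level serves for
  it.\<close>

lemma formation_free_length:
  assumes r: "1 \<le> r"
  shows "\<exists>C. \<forall>d (S :: 'a list). formation_free r (u + 2) S \<longrightarrow> card (set S) \<le> ack d 3 \<longrightarrow>
    length S \<le> C * weight u d * card (set S)"
proof (induction u rule: less_induct)
  case (less u)
  consider "u = 0" | "u = 1" | v where "u = v + 2"
    by (metis One_nat_def add_2_eq_Suc' not0_implies_Suc)
  then show ?case
  proof cases
    case 1
    show ?thesis
    proof (intro exI[of _ "Suc r * (3 * Suc (384 * r * 6))"] allI impI)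
      fix d and S :: "'a list"
      assume "formation_free r (u + 2) S" "card (set S) \<le> ack d 3"
      moreover have "\<not> contains_formation r 3 S" if "\<not> contains_formation r 2 S"
        using that contains_formation_Suc[of r 2 S] by (auto simp: numeral_3_eq_3 numeral_2_eq_2)
      ultimately have "length S \<le> Suc r * (3 * (Suc (384 * r * 6) * card (set S)))"
        using 1 by (intro formation_free_length_3[OF _ _ _ r]) (auto simp: formation_free_def numeral_2_eq_2)
      then show "length S \<le> Suc r * (3 * Suc (384 * r * 6)) * weight u d * card (set S)"
        using 1 by (simp only: mult.assoc weight.simps mult_1)
    qed
  next
    case 2
    show ?thesis
    proof (intro exI[of _ "Suc r * (3 * Suc (384 * r * 6))"] allI impI)
      fix d and S :: "'a list"
      assume "formation_free r (u + 2) S" "card (set S) \<le> ack d 3"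
      then have "length S \<le> Suc r * (3 * (Suc (384 * r * 6) * card (set S)))"
        using 2 by (intro formation_free_length_3[OF _ _ _ r]) (auto simp: formation_free_def numeral_3_eq_3)
      then show "length S \<le> Suc r * (3 * Suc (384 * r * 6)) * weight u d * card (set S)"
        using 2 by (simp only: mult.assoc One_nat_def weight.simps mult_1)
    qed
  next
    case 3
    then obtain C where C: "\<And>d (S :: 'a list). formation_free r u S \<Longrightarrow> card (set S) \<le> ack d 3 \<Longrightarrow>
        length S \<le> C * weight v d * card (set S)"
      using less.IH[of v] by auto
    show ?thesis
    \<comment> \<open>\<open>Suc C\<close> and 2 absorb the successors of \<open>W\<close> and of
      the threshold, since weights and thresholds are positive.\<close>
    proof (intro exI[of _ "Suc C * 2 * Suc (384 * r * 6 ^ u)"] allI impI)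
      fix d and S :: "'a list"
      assume S: "formation_free r (u + 2) S" and n: "card (set S) \<le> ack d 3"
      define W where "W = C * weight v d"
      have "length S \<le> Suc W * (Suc (threshold u (Suc d)) * (Suc (384 * r * 6 ^ u) * card (set S)))"
      proof (rule length_le_chunk_bound[OF _ r _ _ n])
        show "\<not> contains_formation r (u + 2) S" using S by (simp add: formation_free_def)
        show "1 \<le> u" using 3 by simp
        fix X T Y assume T: "S = X @ T @ Y" "\<not> contains_formation r u T"
        have "formation_free r u T"
          using T S sparse_factor[of r X T Y] by (simp add: formation_free_def)
        moreover have "card (set T) \<le> card (set S)" using T(1) by (intro card_mono) auto
        ultimately show "length T \<le> W * card (set T)"
          unfolding W_def using n by (intro C) auto
      qed
      also have "\<dots> \<le> (Suc C * weight v d) * ((2 * threshold u (Suc d)) * (Suc (384 * r * 6 ^ u) * card (set S)))"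
        using weight_pos[of v d] threshold_pos[of u "Suc d"]
        by (intro mult_mono) (auto simp: W_def)
      also have "\<dots> = Suc C * 2 * Suc (384 * r * 6 ^ u) * weight u d * card (set S)"
      proof -
        have "weight u d = weight v d * threshold u (Suc d)" using 3 by simp
        then show ?thesis by (simp only: mult_ac)
      qed
      finally show "length S \<le> Suc C * 2 * Suc (384 * r * 6 ^ u) * weight u d * card (set S)" .
    qed
  qed
qed

section \<open>Growth of the thresholds\<close>

text \<open>It satisfies the recursion that the product in \<open>threshold\<close> obeys on the
  logarithmic scale, and it is a polynomial in \<open>d\<close> of degree \<open>t\<close> with
  leading coefficient \<open>1 / fact t\<close>.\<close>

definition simplicial :: "nat \<Rightarrow> nat \<Rightarrow> nat" where
  "simplicial t d = (d + t) choose t"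

lemma simplicial_0 [simp]: "simplicial 0 d = 1" "simplicial t 0 = 1"
  by (simp_all add: simplicial_def)

lemma simplicial_1: "simplicial (Suc 0) d = Suc d"
  by (simp add: simplicial_def)

lemma simplicial_Suc:
  "simplicial (Suc t) (Suc d) = simplicial (Suc t) d + simplicial t (Suc d)"
  by (simp add: simplicial_def)

lemma simplicial_absorb: "simplicial (Suc t) d * Suc t = (d + Suc t) * simplicial t d"
  using Suc_times_binomial_eq[of "d + t" t] by (simp add: simplicial_def)

lemma simplicial_pos: "0 < simplicial t d"
  by (simp add: simplicial_def)

lemma simplicial_mono: "simplicial t d \<le> simplicial (Suc t) d"
  by (cases d) (simp_all add: simplicial_Suc)

text \<open>The coefficient of \<open>d\<close> in the exponent has to be 1, as it determines the
  leading term later. To this end \<open>Suc d\<close> is bounded by \<open>Suc p * 2 ^ m\<close>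
  with \<open>m = d div Suc p\<close>, so that the power contributes at most
  \<open>2 ^ d\<close>.\<close>

lemma power_le_exp: "\<exists>c. \<forall>d. (K * Suc d) ^ Suc p \<le> (2::nat) ^ (d + c)"
proof (intro exI allI)
  fix d
  define m where "m = d div Suc p"
  have "d < Suc p * Suc m" using dividend_less_times_div[of "Suc p" d] by (simp add: m_def)
  then have "K * Suc d \<le> K * (Suc p * Suc m)" by (intro mult_left_mono) auto
  also have "\<dots> \<le> K * (Suc p * 2 ^ m)"
    by (intro mult_left_mono Suc_leI less_exp) simp_all
  finally have "(K * Suc d) ^ Suc p \<le> (K * (Suc p * 2 ^ m)) ^ Suc p" by (rule power_mono) simp
  also have "\<dots> = (K * Suc p) ^ Suc p * 2 ^ (m * Suc p)"
    by (simp only: power_mult_distrib power_mult mult.assoc)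
  also have "\<dots> \<le> 2 ^ ((K * Suc p) ^ Suc p) * 2 ^ d"
    using less_exp[of "(K * Suc p) ^ Suc p"]
    by (intro mult_mono power_increasing) (auto simp: m_def simp del: mult_Suc_right power_Suc)
  finally show "(K * Suc d) ^ Suc p \<le> 2 ^ (d + (K * Suc p) ^ Suc p)"
    by (simp only: power_add mult.commute)
qed

text \<open>The base \<open>K * Suc d\<close> costs a logarithmic factor in the exponent, while passing from \<open>t\<close> to
  \<open>Suc t\<close> gains a linear one.\<close>

lemma power_simplicial_le:
  "\<exists>c. \<forall>d. (K * Suc d) ^ simplicial t d \<le> (2::nat) ^ (simplicial (Suc t) d + c * simplicial t d)"
proof -
  obtain c where c: "\<And>d. (K * Suc d) ^ Suc t \<le> (2::nat) ^ (d + c)" using power_le_exp by blast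
  have "(K * Suc d) ^ simplicial t d \<le> (2::nat) ^ (simplicial (Suc t) d + c * simplicial t d)" for d
  proof (rule power_le_imp_le_base)
    \<comment> \<open>Comparing \<open>Suc t\<close>-th powers avoids a division:
      \<open>simplicial_absorb\<close> is an identity for \<open>Suc t\<close> times the larger
      exponent.\<close>
    have "((K * Suc d) ^ simplicial t d) ^ Suc t = ((K * Suc d) ^ Suc t) ^ simplicial t d"
      by (simp only: power_mult[symmetric] mult.commute)
    also have "\<dots> \<le> (2 ^ (d + c)) ^ simplicial t d" by (intro power_mono c) simp
    also have "\<dots> = 2 ^ ((d + c) * simplicial t d)" by (simp only: power_mult)
    also have "\<dots> \<le> 2 ^ ((simplicial (Suc t) d + c * simplicial t d) * Suc t)"
      using simplicial_absorb[of t d] by (intro power_increasing) (simp_all add: algebra_simps)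
    finally show "((K * Suc d) ^ simplicial t d) ^ Suc t \<le>
        (2 ^ (simplicial (Suc t) d + c * simplicial t d)) ^ Suc t" by (simp only: power_mult)
  qed simp
  then show ?thesis by blast
qed

section \<open>The threshold recursion, order by order\<close>

lemma threshold_2: "threshold (Suc (Suc 0)) d = 4 * d + 2"
  by (induction d) auto

text \<open>The linear correction turns the recursion into exact doubling.\<close>

lemma threshold_3: "threshold (Suc (Suc (Suc 0))) d + 8 * d + 20 \<le> 22 * 2 ^ d"
  by (induction d) (auto simp: threshold_2)

text \<open>The odd order in between has an exponent of the same degree but the constant base 2, so
  it disappears in the constant \<open>L\<close>.\<close>

lemma threshold_even_step:
  assumes K: "\<And>d. threshold u d \<le> (K * Suc d) ^ simplicial t d"
    and c: "\<And>d. threshold (Suc u) d \<le> 2 ^ (simplicial (Suc t) d + c * simplicial t d)"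
  shows "\<exists>K. \<forall>d. threshold (Suc (Suc u)) d \<le> (K * Suc d) ^ simplicial (Suc t) d"
proof -
  \<comment> \<open>\<open>2 * K\<close> spares a factor 2 in the product and
    \<open>4 * 2 ^ Suc c\<close> a factor 4 in the other term; each of the two is then at most half
    of the bound.\<close>
  define L where "L = 2 * K + 4 * 2 ^ Suc c"
  have "threshold (Suc (Suc u)) d \<le> (L * Suc d) ^ simplicial (Suc t) d" for d
  proof (induction d)
    case (Suc d)
    define a b e where "a = simplicial t (Suc d)" and "b = simplicial (Suc t) d"
      and "e = simplicial (Suc t) (Suc d)"
    define x where "x = Suc (Suc d)"
    have e: "e = a + b" by (simp add: a_def b_def e_def simplicial_Suc)
    have a: "0 < a" by (simp add: a_def simplicial_pos)
    have "2 * (K * x) ^ a \<le> (2 * (K * x)) ^ a"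
      using a self_le_power[of "2 :: nat" a] by (simp add: power_mult_distrib)
    also have "\<dots> \<le> (L * x) ^ a" by (intro power_mono) (auto simp: L_def algebra_simps)
    finally have "2 * (K * x) ^ a * (L * Suc d) ^ b \<le> (L * x) ^ a * (L * x) ^ b"
      by (intro mult_mono power_mono) (auto simp: x_def)
    then have 1: "2 * ((K * x) ^ a * (L * Suc d) ^ b) \<le> (L * x) ^ e"
      by (simp add: e power_add mult.assoc)
    have "simplicial (Suc t) (Suc d) + c * simplicial t (Suc d) \<le> Suc c * e"
      using simplicial_mono[of t "Suc d"] by (simp add: e_def)
    then have "4 * 2 ^ (simplicial (Suc t) (Suc d) + c * simplicial t (Suc d)) \<le> 4 * (2::nat) ^ (Suc c * e)"
      by (intro mult_left_mono power_increasing) auto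
    also have "\<dots> \<le> 4 ^ e * (2 ^ Suc c) ^ e"
      unfolding power_mult using e a self_le_power[of "4 :: nat" e] by (intro mult_right_mono) auto
    also have "\<dots> = (4 * 2 ^ Suc c) ^ e" by (simp only: power_mult_distrib)
    also have "\<dots> \<le> (L * x) ^ e"
    proof (intro power_mono)
      have "4 * 2 ^ Suc c \<le> L * 1" by (simp add: L_def)
      also have "\<dots> \<le> L * x" by (intro mult_left_mono) (auto simp: x_def)
      finally show "4 * 2 ^ Suc c \<le> L * x" .
    qed simp
    finally have 2: "4 * 2 ^ (simplicial (Suc t) (Suc d) + c * simplicial t (Suc d)) \<le> (L * x) ^ e" .
    have "threshold (Suc (Suc u)) (Suc d) \<le>
        (K * x) ^ a * (L * Suc d) ^ b + 2 * 2 ^ (simplicial (Suc t) (Suc d) + c * simplicial t (Suc d))"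
      unfolding threshold.simps a_def b_def x_def
      by (intro add_mono mult_mono K c Suc.IH) auto
    then show ?case using 1 2 unfolding e_def[symmetric] x_def[symmetric] by linarith
  next
    case 0
    have "1 \<le> (2 :: nat) ^ c" by simp
    then have "2 \<le> L" unfolding L_def power_Suc by linarith
    then show ?case by simp
  qed
  then show ?thesis by blast
qed

text \<open>The even order in between has the growing base \<open>K * Suc d\<close>;
  \<open>power_simplicial_le\<close> trades it for the leading term of the next degree.\<close>

lemma threshold_odd_step:
  assumes c: "\<And>d. threshold u d \<le> 2 ^ (simplicial (Suc t) d + c * simplicial t d)"
    and K: "\<And>d. threshold (Suc u) d \<le> (K * Suc d) ^ simplicial (Suc t) d"
  shows "\<exists>c. \<forall>d. threshold (Suc (Suc u)) d \<le>
    2 ^ (simplicial (Suc (Suc t)) d + c * simplicial (Suc t) d)"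
proof -
  obtain c1 where c1: "\<And>d. (K * Suc d) ^ simplicial (Suc t) d \<le>
      (2::nat) ^ (simplicial (Suc (Suc t)) d + c1 * simplicial (Suc t) d)"
    using power_simplicial_le by blast
  \<comment> \<open>\<open>c\<close> and \<open>c1\<close> cover the lower terms of the two
    summands; 2 pays for making each summand at most half of the bound.\<close>
  define c2 where "c2 = c + c1 + 2"
  have "threshold (Suc (Suc u)) d \<le> 2 ^ (simplicial (Suc (Suc t)) d + c2 * simplicial (Suc t) d)" for d
  proof (induction d)
    case 0
    show ?case by (simp add: c2_def)
  next
    case (Suc d)
    define a b where "a = simplicial t (Suc d)" and "b = simplicial (Suc t) d"
    define f where "f = simplicial (Suc (Suc t)) d"
    define X where "X = simplicial (Suc (Suc t)) (Suc d) + c2 * simplicial (Suc t) (Suc d)"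
    have X: "X = f + (a + b) + c2 * (a + b)"
      by (simp add: X_def a_def b_def f_def simplicial_Suc)
    have a: "0 < a" by (simp add: a_def simplicial_pos)
    have "2 * (2 ^ (simplicial (Suc t) (Suc d) + c * a) * 2 ^ (f + c2 * b)) =
        (2::nat) ^ Suc ((a + b + c * a) + (f + c2 * b))"
      by (simp add: power_add a_def b_def simplicial_Suc mult_ac)
    also have "\<dots> \<le> 2 ^ X"
      unfolding X using a by (intro power_increasing) (auto simp: c2_def algebra_simps)
    finally have 1: "2 * (2 ^ (simplicial (Suc t) (Suc d) + c * a) * 2 ^ (f + c2 * b)) \<le> (2::nat) ^ X" .
    have "4 * (K * Suc (Suc d)) ^ simplicial (Suc t) (Suc d) \<le>
        4 * (2::nat) ^ (simplicial (Suc (Suc t)) (Suc d) + c1 * simplicial (Suc t) (Suc d))"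
      by (intro mult_left_mono c1) simp
    also have "\<dots> = 2 ^ (2 + (simplicial (Suc (Suc t)) (Suc d) + c1 * simplicial (Suc t) (Suc d)))"
      by (simp add: power_add)
    also have "\<dots> \<le> 2 ^ X"
      using simplicial_pos[of "Suc t" "Suc d"] unfolding X_def
      by (intro power_increasing) (auto simp: c2_def algebra_simps)
    finally have 2: "4 * (K * Suc (Suc d)) ^ simplicial (Suc t) (Suc d) \<le> 2 ^ X" .
    have "threshold (Suc (Suc u)) (Suc d) \<le>
        2 ^ (simplicial (Suc t) (Suc d) + c * a) * 2 ^ (f + c2 * b)
        + 2 * (K * Suc (Suc d)) ^ simplicial (Suc t) (Suc d)"
      unfolding threshold.simps a_def b_def f_def
      by (intro add_mono mult_mono K c Suc.IH) auto
    then show ?case using 1 2 unfolding X_def[symmetric] by linarith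
  qed
  then show ?thesis by blast
qed

text \<open>Both parities are proved together, as each order refers to the two before it.\<close>

lemma threshold_bounds:
  "(\<exists>K. \<forall>d. threshold (2 * t + 2) d \<le> (K * Suc d) ^ simplicial t d) \<and>
   (\<exists>c. \<forall>d. threshold (2 * t + 3) d \<le> 2 ^ (simplicial (Suc t) d + c * simplicial t d))"
proof (induction t)
  case 0
  have "threshold (2 * 0 + 2) d \<le> (4 * Suc d) ^ simplicial 0 d" for d
    using threshold_2[of d] by (simp add: numeral_2_eq_2)
  moreover have "threshold (2 * 0 + 3) d \<le> 2 ^ (simplicial (Suc 0) d + 4 * simplicial 0 d)" for d
    using threshold_3[of d] by (simp add: simplicial_1 numeral_3_eq_3 power_add)
  ultimately show ?case by blast
next
  case (Suc t)
  then obtain K c where K: "\<And>d. threshold (2 * t + 2) d \<le> (K * Suc d) ^ simplicial t d"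
    and c: "\<And>d. threshold (Suc (2 * t + 2)) d \<le> 2 ^ (simplicial (Suc t) d + c * simplicial t d)"
    by (auto simp: numeral_3_eq_3)
  obtain L where L: "\<And>d. threshold (Suc (Suc (2 * t + 2))) d \<le> (L * Suc d) ^ simplicial (Suc t) d"
    using threshold_even_step[OF K c] by blast
  have "\<exists>c. \<forall>d. threshold (Suc (Suc (Suc (2 * t + 2)))) d \<le>
      2 ^ (simplicial (Suc (Suc t)) d + c * simplicial (Suc t) d)"
    by (rule threshold_odd_step[OF c L])
  moreover have "2 * Suc t + 2 = Suc (Suc (2 * t + 2))" "2 * Suc t + 3 = Suc (Suc (Suc (2 * t + 2)))"
    by simp_all
  ultimately show ?case using L by (simp only:) blast
qed

text \<open>The threshold of the highest order dominates the product: the leading exponents of the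
  others have lower degree and join the error term.\<close>

lemma weight_odd:
  "\<exists>c. \<forall>d. weight (2 * t + 3) d \<le> 2 ^ (simplicial (Suc t) (Suc d) + c * simplicial t (Suc d))"
proof (induction t)
  case 0
  obtain c where c: "\<And>d. threshold (2 * 0 + 3) d \<le> 2 ^ (simplicial (Suc 0) d + c * simplicial 0 d)"
    using threshold_bounds[of 0] by blast
  have "weight (2 * 0 + 3) d = threshold (2 * 0 + 3) (Suc d)" for d
    by (simp only: numeral_3_eq_3 mult_0_right add_0 weight.simps mult_1)
  then show ?case using c by (intro exI[of _ c]) (simp only: simplicial_0 simp_thms)
next
  case (Suc t)
  then obtain c where c: "\<And>d. weight (2 * t + 3) d \<le> 2 ^ (simplicial (Suc t) (Suc d) + c * simplicial t (Suc d))"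
    by blast
  obtain c1 where c1: "\<And>d. threshold (2 * Suc t + 3) d \<le> 2 ^ (simplicial (Suc (Suc t)) d + c1 * simplicial (Suc t) d)"
    using threshold_bounds[of "Suc t"] by blast
  have eq: "2 * Suc t + 3 = Suc (Suc (2 * t + 3))" by simp
  have "weight (2 * Suc t + 3) d \<le>
      2 ^ (simplicial (Suc (Suc t)) (Suc d) + (1 + c + c1) * simplicial (Suc t) (Suc d))" for d
  proof -
    have "weight (2 * Suc t + 3) d \<le> 2 ^ (simplicial (Suc t) (Suc d) + c * simplicial t (Suc d)) *
        2 ^ (simplicial (Suc (Suc t)) (Suc d) + c1 * simplicial (Suc t) (Suc d))"
      using c c1 unfolding eq weight.simps by (intro mult_mono) auto
    also have "\<dots> \<le> 2 ^ (simplicial (Suc (Suc t)) (Suc d) + (1 + c + c1) * simplicial (Suc t) (Suc d))"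
      unfolding power_add[symmetric] using mult_left_mono[OF simplicial_mono[of t "Suc d"], of c]
      by (intro power_increasing) (auto simp: algebra_simps)
    finally show ?thesis .
  qed
  then show ?case by blast
qed

text \<open>Likewise, but the lower factors are absorbed into the constant in the base of the
  power.\<close>

lemma weight_even:
  "\<exists>K. \<forall>d. weight (2 * t + 2) d \<le> (K * Suc (Suc d)) ^ simplicial t (Suc d)"
proof (induction t)
  case 0
  obtain K where K: "\<And>d. threshold (2 * 0 + 2) d \<le> (K * Suc d) ^ simplicial 0 d"
    using threshold_bounds[of 0] by blast
  have "weight (2 * 0 + 2) d = threshold (2 * 0 + 2) (Suc d)" for d
    by (simp only: numeral_2_eq_2 mult_0_right add_0 weight.simps mult_1)
  then show ?case using K[of "Suc _"] by (intro exI[of _ K]) (simp only: simplicial_0 simp_thms)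
next
  case (Suc t)
  then obtain K where K: "\<And>d. weight (2 * t + 2) d \<le> (K * Suc (Suc d)) ^ simplicial t (Suc d)"
    by blast
  obtain c where c: "\<And>d. (K * Suc d) ^ simplicial t d \<le> (2::nat) ^ (simplicial (Suc t) d + c * simplicial t d)"
    using power_simplicial_le by blast
  obtain L where L: "\<And>d. threshold (2 * Suc t + 2) d \<le> (L * Suc d) ^ simplicial (Suc t) d"
    using threshold_bounds[of "Suc t"] by blast
  have eq: "2 * Suc t + 2 = Suc (Suc (2 * t + 2))" by simp
  have "weight (2 * Suc t + 2) d \<le> (2 ^ Suc c * L * Suc (Suc d)) ^ simplicial (Suc t) (Suc d)" for d
  proof -
    have "weight (2 * t + 2) d \<le> 2 ^ (simplicial (Suc t) (Suc d) + c * simplicial t (Suc d))"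
      using K c order_trans by blast
    also have "\<dots> \<le> 2 ^ (Suc c * simplicial (Suc t) (Suc d))"
      using simplicial_mono[of t "Suc d"] by (intro power_increasing) auto
    finally have w: "weight (2 * t + 2) d \<le> (2 ^ Suc c) ^ simplicial (Suc t) (Suc d)"
      by (simp only: power_mult)
    have "weight (2 * Suc t + 2) d \<le>
        (2 ^ Suc c) ^ simplicial (Suc t) (Suc d) * (L * Suc (Suc d)) ^ simplicial (Suc t) (Suc d)"
      unfolding eq weight.simps by (intro mult_mono w L[unfolded eq]) simp_all
    then show ?thesis by (simp only: power_mult_distrib mult.assoc)
  qed
  then show ?case by blast
qed

section \<open>Passage to real exponents\<close>

lemma power_shift_le:
  fixes a :: real
  assumes "0 \<le> a"
  shows "\<exists>c\<ge>0. \<forall>d\<ge>1. (d + a) ^ t \<le> d ^ t + c * d ^ t / d"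
proof (induction t)
  case (Suc t)
  then obtain c where c: "c \<ge> 0" "\<And>d. d \<ge> 1 \<Longrightarrow> (d + a) ^ t \<le> d ^ t + c * d ^ t / d" by blast
  have "(d + a) ^ Suc t \<le> d ^ Suc t + (c + a + a * c) * d ^ Suc t / d" if d: "d \<ge> 1" for d
  proof -
    have "(d + a) ^ Suc t \<le> (d + a) * (d ^ t + c * d ^ t / d)"
      using c(2)[OF d] d assms by (simp add: mult_left_mono)
    also have "\<dots> = d ^ Suc t + (c + a) * d ^ t + a * c * d ^ t / d"
      using d by (simp add: field_simps)
    also have "a * c * d ^ t / d \<le> a * c * d ^ t"
      using divide_left_mono[of 1 d "a * c * d ^ t"] d assms c(1) by simp
    finally have "(d + a) ^ Suc t \<le> d ^ Suc t + (c + a) * d ^ t + a * c * d ^ t" by simp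
    moreover have "(c + a + a * c) * d ^ Suc t / d = (c + a) * d ^ t + a * c * d ^ t"
      using d by (simp add: add_divide_distrib distrib_right)
    ultimately show ?thesis by linarith
  qed
  then show ?case using c(1) assms by (intro exI[of _ "c + a + a * c"]) auto
qed (auto intro: exI[of _ 0])

text \<open>The error is written \<open>d ^ t / d\<close>, not \<open>d ^ (t - 1)\<close>: for
  \<open>t = 0\<close> the truncated exponent would leave a constant, which times
  \<open>log 2 d\<close> exceeds the error allowed for even orders.\<close>

lemma simplicial_le:
  "\<exists>c\<ge>0. \<forall>d\<ge>1. real (simplicial t (Suc d)) \<le> (1 / fact t) * real d ^ t + c * real d ^ t / real d"
proof -
  obtain c :: real where c: "c \<ge> 0" "\<And>d. d \<ge> 1 \<Longrightarrow> (d + real (Suc t)) ^ t \<le> d ^ t + c * d ^ t / d"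
    using power_shift_le[of "real (Suc t)" t] by auto
  have "real (simplicial t (Suc d)) \<le> (1 / fact t) * real d ^ t + c * real d ^ t / real d" if "d \<ge> 1" for d
  proof -
    have "simplicial t (Suc d) * fact t \<le> (d + Suc t) ^ t"
      using binomial_fact_pow[of "Suc d + t" t] by (simp add: simplicial_def)
    then have "real (simplicial t (Suc d) * fact t) \<le> real ((d + Suc t) ^ t)" by (rule of_nat_mono)
    then have "real (simplicial t (Suc d)) * fact t \<le> (real d + real (Suc t)) ^ t"
      by (simp add: add_ac)
    also have "\<dots> \<le> real d ^ t + c * real d ^ t / real d" using that by (intro c) simp
    finally have "real (simplicial t (Suc d)) \<le> (real d ^ t + c * real d ^ t / real d) / fact t"
      by (simp add: pos_le_divide_eq)
    also have "\<dots> = (1 / fact t) * real d ^ t + (c * real d ^ t / real d) / fact t"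
      by (simp add: add_divide_distrib)
    also have "(c * real d ^ t / real d) / fact t \<le> (c * real d ^ t / real d) / 1"
      using c(1) by (intro divide_left_mono) (auto simp: fact_ge_1)
    finally show ?thesis by simp
  qed
  then show ?thesis using c(1) by blast
qed

text \<open>Inverting the hierarchy at \<open>inv_ackermann n\<close>, where its value is at most 3,
  shows that this level suffices for \<open>n\<close> symbols.\<close>

lemma F_le_weight:
  assumes "1 \<le> r"
  shows "\<exists>C. \<forall>n. F r (u + 2) n \<le> C * weight u (inv_ackermann n) * n"
proof -
  obtain C where C: "\<And>d (S :: nat list). formation_free r (u + 2) S \<Longrightarrow> card (set S) \<le> ack d 3 \<Longrightarrow>
      length S \<le> C * weight u d * card (set S)"
    using formation_free_length[OF assms, of u] by blast
  have "F r (u + 2) n \<le> C * weight u (inv_ackermann n) * n" for n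
  proof -
    have "1 \<le> inv_ackermann n \<and> alpha_k (inv_ackermann n) n \<le> 3"
      unfolding inv_ackermann_def by (rule LeastI_ex) (use ex_alpha_k_le_3 in blast)
    then have n: "n \<le> ack (inv_ackermann n) 3" using le_ack_alpha_k by blast
    have "F r (u + 2) n \<in> formation_free_lengths r (u + 2) n"
      unfolding F_def
      using finite_formation_free_lengths[OF assms] formation_free_lengths_nonempty[OF assms, of "u + 2" n]
      by (intro Max_in) auto
    then show ?thesis using C n by (auto simp: formation_free_lengths_def)
  qed
  then show ?thesis by blast
qed

lemma inv_ackermann_ge_1: "1 \<le> inv_ackermann n"
  unfolding inv_ackermann_def using LeastI_ex[of "\<lambda>k. 1 \<le> k \<and> alpha_k k n \<le> 3"] ex_alpha_k_le_3 by blast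

lemma of_nat_le_2_powr: "real n \<le> 2 powr real n"
  using less_exp[of n] by (simp add: powr_realpow flip: of_nat_le_iff less_imp_le)

lemma F_odd_bound:
  assumes "1 \<le> r"
  shows "\<exists>D. \<forall>n. real (F r (2 * t + 5) n) \<le> real n * 2 powr
    ((1 / fact (Suc t)) * real (inv_ackermann n) ^ Suc t + D * real (inv_ackermann n) ^ t)"
proof -
  have eq: "2 * t + 3 + 2 = 2 * t + 5" by simp
  obtain C where C: "\<And>n. F r (2 * t + 5) n \<le> C * weight (2 * t + 3) (inv_ackermann n) * n"
    using F_le_weight[OF assms, of "2 * t + 3"] unfolding eq by blast
  obtain c where c: "\<And>d. weight (2 * t + 3) d \<le> 2 ^ (simplicial (Suc t) (Suc d) + c * simplicial t (Suc d))"
    using weight_odd by blast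
  obtain c1 where c1: "\<And>d. d \<ge> 1 \<Longrightarrow> real (simplicial (Suc t) (Suc d)) \<le>
      (1 / fact (Suc t)) * real d ^ Suc t + c1 * real d ^ Suc t / real d"
    using simplicial_le by blast
  obtain c2 where c2: "c2 \<ge> 0" "\<And>d. d \<ge> 1 \<Longrightarrow> real (simplicial t (Suc d)) \<le>
      (1 / fact t) * real d ^ t + c2 * real d ^ t / real d"
    using simplicial_le by blast
  have pw: "(2 :: real) ^ m = 2 powr real m" for m by (simp add: powr_realpow)
  \<comment> \<open>\<open>C\<close> enters through \<open>C \<le> 2 powr C\<close> and
    \<open>1 \<le> d ^ t\<close>, \<open>c1\<close> is the error of the leading polynomial, and the
    last summand bounds the lower one.\<close>
  define D where "D = real C + c1 + real c * (1 + c2)"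
  have "real (F r (2 * t + 5) n) \<le> real n * 2 powr
      ((1 / fact (Suc t)) * real (inv_ackermann n) ^ Suc t + D * real (inv_ackermann n) ^ t)" for n
  proof -
    define d where "d = inv_ackermann n"
    have d: "1 \<le> d" unfolding d_def by (rule inv_ackermann_ge_1)
    have p: "1 \<le> real d ^ t" using d by simp
    have "real (F r (2 * t + 5) n) \<le> real (C * weight (2 * t + 3) d * n)"
      unfolding d_def by (rule of_nat_mono[OF C])
    also have "\<dots> \<le> real n * (real C * 2 ^ (simplicial (Suc t) (Suc d) + c * simplicial t (Suc d)))"
      using c[of d] by (simp add: mult_left_mono mult_ac flip: of_nat_le_iff)
    also have "real C * 2 ^ (simplicial (Suc t) (Suc d) + c * simplicial t (Suc d)) \<le>
        2 powr real C * 2 powr real (simplicial (Suc t) (Suc d) + c * simplicial t (Suc d))"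
      unfolding pw by (intro mult_right_mono of_nat_le_2_powr) simp
    also have "\<dots> = 2 powr (real C + real (simplicial (Suc t) (Suc d)) + real c * real (simplicial t (Suc d)))"
      by (simp add: powr_add)
    also have "\<dots> \<le> 2 powr ((1 / fact (Suc t)) * real d ^ Suc t + D * real d ^ t)"
    proof (rule powr_mono)
      have "c1 * real d ^ Suc t / real d = c1 * real d ^ t" using d by simp
      then have 1: "real (simplicial (Suc t) (Suc d)) \<le> (1 / fact (Suc t)) * real d ^ Suc t + c1 * real d ^ t"
        using c1[OF d] by linarith
      have "(1 / fact t) * real d ^ t \<le> 1 * real d ^ t"
        by (intro mult_right_mono) (auto simp: fact_ge_1)
      moreover have "c2 * real d ^ t / real d \<le> c2 * real d ^ t / 1"
        using d c2(1) by (intro divide_left_mono) auto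
      ultimately have "real (simplicial t (Suc d)) \<le> (1 + c2) * real d ^ t"
        using c2(2)[OF d] by (simp add: algebra_simps)
      then have 2: "real c * real (simplicial t (Suc d)) \<le> real c * ((1 + c2) * real d ^ t)"
        by (rule mult_left_mono) simp
      have 3: "real C \<le> real C * real d ^ t" using p by (simp add: mult_le_cancel_left1)
      show "real C + real (simplicial (Suc t) (Suc d)) + real c * real (simplicial t (Suc d)) \<le>
          (1 / fact (Suc t)) * real d ^ Suc t + D * real d ^ t"
        using 1 2 3 unfolding D_def by (simp add: algebra_simps)
    qed simp
    finally show ?thesis by (simp add: d_def mult_left_mono)
  qed
  then show ?thesis by blast
qed

lemma F_even_bound:
  assumes "1 \<le> r"
  shows "\<exists>D. \<forall>n. real (F r (2 * t + 4) n) \<le> real n * 2 powr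
    ((1 / fact t) * real (inv_ackermann n) ^ t * log 2 (real (inv_ackermann n))
      + D * real (inv_ackermann n) ^ t)"
proof -
  have eq: "2 * t + 2 + 2 = 2 * t + 4" by simp
  obtain C where C: "\<And>n. F r (2 * t + 4) n \<le> C * weight (2 * t + 2) (inv_ackermann n) * n"
    using F_le_weight[OF assms, of "2 * t + 2"] unfolding eq by blast
  obtain K where K: "\<And>d. weight (2 * t + 2) d \<le> (K * Suc (Suc d)) ^ simplicial t (Suc d)"
    using weight_even by blast
  obtain c where c: "c \<ge> 0" "\<And>d. d \<ge> 1 \<Longrightarrow> real (simplicial t (Suc d)) \<le>
      (1 / fact t) * real d ^ t + c * real d ^ t / real d"
    using simplicial_le by blast
  \<comment> \<open>\<open>Suc (Suc d) \<le> 3 * d\<close> for \<open>d \<ge> 1\<close>, so the base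
    is at most \<open>2 powr M * d\<close>.\<close>
  define M where "M = real (3 * K)"
  define D where "D = real C + c + (1 + c) * M"
  have "real (F r (2 * t + 4) n) \<le> real n * 2 powr
      ((1 / fact t) * real (inv_ackermann n) ^ t * log 2 (real (inv_ackermann n))
        + D * real (inv_ackermann n) ^ t)" for n
  proof -
    define d where "d = inv_ackermann n"
    define h where "h = real (simplicial t (Suc d))"
    define l where "l = log 2 (real d)"
    have d: "1 \<le> d" unfolding d_def by (rule inv_ackermann_ge_1)
    have p: "1 \<le> real d ^ t" using d by simp
    have l: "0 \<le> l" "l \<le> real d" "real d = 2 powr l"
    proof -
      show "0 \<le> l" "real d = 2 powr l" using d by (simp_all add: l_def)
      show "l \<le> real d" using d of_nat_le_2_powr[of d] by (simp add: l_def log_le_iff)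
    qed
    have "K * Suc (Suc d) \<le> 3 * K * d" using d by (cases d) auto
    then have "real (K * Suc (Suc d)) \<le> real (3 * K * d)" by (rule of_nat_mono)
    also have "\<dots> = real (3 * K) * real d" by (rule of_nat_mult)
    also have "\<dots> \<le> 2 powr M * 2 powr l"
      unfolding M_def l(3)[symmetric] by (intro mult_right_mono of_nat_le_2_powr) simp
    finally have base: "real (K * Suc (Suc d)) \<le> 2 powr (M + l)" by (simp only: powr_add)
    have "real (weight (2 * t + 2) d) \<le> real ((K * Suc (Suc d)) ^ simplicial t (Suc d))"
      by (rule of_nat_mono[OF K])
    also have "\<dots> = real (K * Suc (Suc d)) ^ simplicial t (Suc d)" by (rule of_nat_power)
    also have "\<dots> \<le> (2 powr (M + l)) ^ simplicial t (Suc d)" by (intro power_mono base) simp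
    also have "\<dots> = 2 powr ((M + l) * h)" by (simp add: h_def powr_powr flip: powr_realpow)
    finally have w: "real (weight (2 * t + 2) d) \<le> 2 powr ((M + l) * h)" .
    have "real (F r (2 * t + 4) n) \<le> real (C * weight (2 * t + 2) d * n)"
      unfolding d_def by (rule of_nat_mono[OF C])
    also have "\<dots> = real n * (real C * real (weight (2 * t + 2) d))" by simp
    also have "\<dots> \<le> real n * (2 powr real C * 2 powr ((M + l) * h))"
      by (intro mult_left_mono mult_mono of_nat_le_2_powr w) auto
    also have "2 powr real C * 2 powr ((M + l) * h) = 2 powr (real C + (M + l) * h)"
      by (simp only: powr_add)
    also have "\<dots> \<le> 2 powr ((1 / fact t) * real d ^ t * l + D * real d ^ t)"
    proof (rule powr_mono)
      have "h * l \<le> ((1 / fact t) * real d ^ t + c * real d ^ t / real d) * l"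
        unfolding h_def using c(2)[OF d] l(1) by (rule mult_right_mono)
      also have "\<dots> = (1 / fact t) * real d ^ t * l + c * real d ^ t * (l / real d)"
        by (simp add: algebra_simps)
      \<comment> \<open>\<open>log 2 d \<le> d\<close> cancels the division by \<open>d\<close> in
        the error, which leaves order \<open>d ^ t\<close>.\<close>
      also have "c * real d ^ t * (l / real d) \<le> c * real d ^ t * 1"
        using d c(1) l(2) by (intro mult_left_mono) auto
      finally have 1: "h * l \<le> (1 / fact t) * real d ^ t * l + c * real d ^ t" by simp
      have "(1 / fact t) * real d ^ t \<le> 1 * real d ^ t"
        by (intro mult_right_mono) (auto simp: fact_ge_1)
      moreover have "c * real d ^ t / real d \<le> c * real d ^ t / 1"
        using d c(1) by (intro divide_left_mono) auto
      ultimately have "h \<le> (1 + c) * real d ^ t"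
        using c(2)[OF d] by (simp add: algebra_simps h_def)
      then have 2: "M * h \<le> M * ((1 + c) * real d ^ t)" by (rule mult_left_mono) (simp add: M_def)
      have 3: "real C \<le> real C * real d ^ t" using p by (simp add: mult_le_cancel_left1)
      show "real C + (M + l) * h \<le> (1 / fact t) * real d ^ t * l + D * real d ^ t"
        using 1 2 3 unfolding D_def by (simp add: algebra_simps)
    qed simp
    finally show ?thesis by (simp add: d_def l_def mult_left_mono)
  qed
  then show ?thesis by blast
qed

theorem theorem1p3:
  fixes r s t :: nat
  assumes "r \<ge> 1" and "s \<ge> 4" and "t = nat \<lfloor>(real s - 3) / 2\<rfloor>"
  shows "(odd s \<longrightarrow>
           (\<exists>E :: nat \<Rightarrow> real. E \<in> O(\<lambda>n. real (inv_ackermann n) ^ (t - 1)) \<and>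
             (\<forall>\<^sub>F n in sequentially.
               real (F r s n) \<le> real n * 2 powr
                 ((1 / fact t) * real (inv_ackermann n) ^ t + E n)))) \<and>
         (even s \<longrightarrow>
           (\<exists>E :: nat \<Rightarrow> real. E \<in> O(\<lambda>n. real (inv_ackermann n) ^ t) \<and>
             (\<forall>\<^sub>F n in sequentially.
               real (F r s n) \<le> real n * 2 powr
                 ((1 / fact t) * real (inv_ackermann n) ^ t * log 2 (real (inv_ackermann n)) + E n))))"
proof (intro conjI impI)
  assume "odd s"
  then obtain k where "s = 2 * k + 1" by (elim oddE)
  then obtain t' where s: "s = 2 * t' + 5"
    using assms(2) by (intro that[of "k - 2"]) simp
  \<comment> \<open>An odd \<open>s\<close> is at least 5, so \<open>t\<close> is positive and
    \<open>t - 1\<close> is a true predecessor.\<close>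
  have "\<lfloor>(real s - 3) / 2\<rfloor> = int (Suc t')" by (rule floor_unique) (simp_all add: s field_simps)
  then have t: "t = Suc t'" unfolding assms(3) by simp
  obtain D where D: "\<And>n. real (F r s n) \<le> real n * 2 powr
      ((1 / fact t) * real (inv_ackermann n) ^ t + D * real (inv_ackermann n) ^ (t - 1))"
    using F_odd_bound[OF assms(1), of t'] unfolding s t by auto
  then show "\<exists>E :: nat \<Rightarrow> real. E \<in> O(\<lambda>n. real (inv_ackermann n) ^ (t - 1)) \<and>
      (\<forall>\<^sub>F n in sequentially. real (F r s n) \<le> real n * 2 powr
        ((1 / fact t) * real (inv_ackermann n) ^ t + E n))"
    by (intro exI[of _ "\<lambda>n. D * real (inv_ackermann n) ^ (t - 1)"] conjI) auto
next
  assume "even s"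
  then obtain k where "s = 2 * k" by (elim evenE)
  then obtain t' where s: "s = 2 * t' + 4"
    using assms(2) by (intro that[of "k - 2"]) simp
  have "\<lfloor>(real s - 3) / 2\<rfloor> = int t'" by (rule floor_unique) (simp_all add: s field_simps)
  then have t: "t = t'" unfolding assms(3) by simp
  obtain D where D: "\<And>n. real (F r s n) \<le> real n * 2 powr
      ((1 / fact t) * real (inv_ackermann n) ^ t * log 2 (real (inv_ackermann n))
        + D * real (inv_ackermann n) ^ t)"
    using F_even_bound[OF assms(1), of t'] unfolding s t by auto
  then show "\<exists>E :: nat \<Rightarrow> real. E \<in> O(\<lambda>n. real (inv_ackermann n) ^ t) \<and>
      (\<forall>\<^sub>F n in sequentially. real (F r s n) \<le> real n * 2 powr
        ((1 / fact t) * real (inv_ackermann n) ^ t * log 2 (real (inv_ackermann n)) + E n))"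
    by (intro exI[of _ "\<lambda>n. D * real (inv_ackermann n) ^ t"] conjI) auto
qed

end
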